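(* Let $n\ge 0$ be an integer, let $\nu\in\mathbb{R}$, and let $t\in\mathbb{C}$ with $\Re t>0$. Then $$\frac{\partial^{n}}{\partial\nu^{n}}J_{\nu}(t)=\frac{1}{\pi}\int_{0}^{\pi}x^{n}\cos\left(t\sin x-\nu x-\frac{\pi}{2}n\right)dx-\frac{1}{\pi}\int_{0}^{\infty}e^{-t\sinh x-\nu x}\,\Im\left[(i\pi-x)^{n}e^{i\pi\nu}\right]dx$$ $$=\frac{1}{\pi}\int_{0}^{\pi}x^{n}\cos\left(t\sin x-\nu x-\frac{\pi}{2}n\right)dx-\frac{1}{\pi}\int_{0}^{\infty}e^{-t\sinh x-\nu x}\left[p_{n}(x)\sin\pi\nu+q_{n}(x)\cos\pi\nu\right]dx .$$
   Context: $J_\nu(t)=\sum_{k=0}^{\infty}\frac{(-1)^k}{k!\,\Gamma(k+\nu+1)}\left(\frac{t}{2}\right)^{2k+\nu}$ is the Bessel function of the first kind (principal branch, $-\pi<\arg t\le\pi$; $1/\Gamma$ is zero at the poles of $\Gamma$). $\Re$ and $\Im$ denote real and imaginary parts. For real $x$, the polynomials $p_n,q_n$ are $p_{n}(x)=\Re\left[(i\pi-x)^{n}\right]=\sum_{k=0}^{\lfloor n/2\rfloor}\binom{n}{2k}(-1)^{n+k}\pi^{2k}x^{n-2k}$ and $q_{n}(x)=\Im\left[(i\pi-x)^{n}\right]=\sum_{k=0}^{\lfloor (n-1)/2\rfloor}\binom{n}{2k+1}(-1)^{n+k+1}\pi^{2k+1}x^{n-2k-1}$ (empty sums are $0$). 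*)

theory Defs
  imports "HOL-Analysis.Analysis"
begin

text \<open>
  The power is the principal one, since \<open>powr\<close> on \<open>complex\<close> is defined through \<open>Ln\<close> with
  \<open>- pi < Im (Ln z) \<le> pi\<close>; \<open>rGamma\<close> is the entire function \<open>1 / Gamma\<close>, zero at the poles
  of \<open>Gamma\<close>. As \<open>0 powr z = 0\<close>, this is meant for \<open>t \<noteq> 0\<close> only: \<open>Bessel_J 0 0\<close> is \<open>0\<close>, not \<open>1\<close>.
\<close>

definition Bessel_J :: "complex \<Rightarrow> complex \<Rightarrow> complex" where
  "Bessel_J \<nu> t =
     (\<Sum>k. (-1) ^ k / fact k * rGamma (of_nat k + \<nu> + 1) * (t / 2) powr (2 * of_nat k + \<nu>))"

text \<open>
  \<open>has_nth_vector_derivative n f D x\<close>: the \<open>n\<close>-th derivative of \<open>f\<close> at \<open>x\<close> exists and equals \<open>D\<close>.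
  As usual, the derivative of order \<open>n\<close> has to exist in a neighbourhood of \<open>x\<close> for the one of
  order \<open>n + 1\<close> to be defined at \<open>x\<close>.
\<close>

primrec has_nth_vector_derivative ::
  "nat \<Rightarrow> (real \<Rightarrow> 'a::real_normed_vector) \<Rightarrow> 'a \<Rightarrow> real \<Rightarrow> bool" where
  "has_nth_vector_derivative 0 f D x \<longleftrightarrow> f x = D"
| "has_nth_vector_derivative (Suc n) f D x \<longleftrightarrow>
     (\<exists>g. (\<forall>\<^sub>F y in nhds x. has_nth_vector_derivative n f (g y) y) \<and>
          (g has_vector_derivative D) (at x))"

lemma has_nth_vector_derivative_unique:
  "has_nth_vector_derivative n f D x \<Longrightarrow> has_nth_vector_derivative n f E x \<Longrightarrow> D = E"
proof (induction n arbitrary: D E x)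
  case 0
  then show ?case by simp
next
  case (Suc n)
  obtain g where g: "\<forall>\<^sub>F y in nhds x. has_nth_vector_derivative n f (g y) y"
    "(g has_vector_derivative D) (at x)" using Suc.prems(1) by auto
  obtain h where h: "\<forall>\<^sub>F y in nhds x. has_nth_vector_derivative n f (h y) y"
    "(h has_vector_derivative E) (at x)" using Suc.prems(2) by auto
  have ev: "\<forall>\<^sub>F y in nhds x. g y = h y"
    using g(1) h(1) by eventually_elim (rule Suc.IH)
  have "(h has_vector_derivative D) (at x)"
    using has_vector_derivative_cong_ev[where S=UNIV and f=g and g=h and x=x and f'=D]
      ev g(2) eventually_nhds_x_imp_x[OF ev] by simp
  with h(2) show ?case by (meson vector_derivative_unique_at)
qed

definition p_poly :: "nat \<Rightarrow> real \<Rightarrow> real" where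
  "p_poly n x = Re ((\<i> * of_real pi - of_real x) ^ n)"

definition q_poly :: "nat \<Rightarrow> real \<Rightarrow> real" where
  "q_poly n x = Im ((\<i> * of_real pi - of_real x) ^ n)"

lemma ipi_minus_power_expand:
  "(\<i> * of_real pi - of_real x) ^ n =
     (\<Sum>j\<le>n. of_nat (n choose j) * \<i> ^ j * of_real (pi ^ j * (- x) ^ (n - j)))"
proof -
  have "(\<i> * of_real pi - of_real x) ^ n = (\<i> * of_real pi + of_real (- x)) ^ n"
    by simp
  also have "\<dots> = (\<Sum>j\<le>n. of_nat (n choose j) * (\<i> * of_real pi) ^ j * of_real (- x) ^ (n - j))"
    by (rule binomial_ring)
  finally show ?thesis
    by (simp add: power_mult_distrib mult.assoc)
qed

lemma p_poly_altdef:
  "p_poly n x =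
     (\<Sum>k\<le>n div 2. real (n choose (2*k)) * (-1) ^ (n + k) * pi ^ (2*k) * x ^ (n - 2*k))"
proof -
  let ?c = "\<lambda>j. real (n choose j) * Re (\<i> ^ j) * (pi ^ j * (- x) ^ (n - j))"
  have "p_poly n x = (\<Sum>j\<le>n. ?c j)"
    unfolding p_poly_def ipi_minus_power_expand Re_sum
    by (intro sum.cong refl) simp
  also have "\<dots> = (\<Sum>j\<in>(\<lambda>k. 2*k) ` {..n div 2}. ?c j)"
  proof (rule sum.mono_neutral_right)
    have "Re (\<i> ^ j) = 0" if "j \<le> n" "j \<notin> (\<lambda>k. 2*k) ` {..n div 2}" for j
    proof -
      have "odd j" using that by (auto elim!: evenE)
      then obtain m where "j = 2*m+1" by (elim oddE)
      then have "\<i> ^ j = of_real ((-1) ^ m) * \<i>" by (simp add: power_mult)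
      then show ?thesis by simp
    qed
    then show "\<forall>j\<in>{..n} - (\<lambda>k. 2*k) ` {..n div 2}. ?c j = 0" by auto
  qed auto
  also have "\<dots> = (\<Sum>k\<le>n div 2. ?c (2*k))"
    by (subst sum.reindex) (auto simp: inj_on_def)
  also have "\<dots> = (\<Sum>k\<le>n div 2. real (n choose (2*k)) * (-1) ^ (n + k) * pi ^ (2*k) * x ^ (n - 2*k))"
  proof (intro sum.cong refl)
    fix k assume "k \<in> {..n div 2}"
    then have k: "2*k \<le> n" by auto
    have "\<i> ^ (2*k) = of_real ((-1) ^ k)" by (simp add: power_mult)
    then have r: "Re (\<i> ^ (2*k)) = (-1) ^ k" by (simp only: Re_complex_of_real)
    obtain m where "n = 2*k + m" using k le_iff_add by blast
    then have "(-1::real) ^ n = (-1) ^ (n - 2*k)" by (simp add: power_add)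
    then have "(- x) ^ (n - 2*k) = (-1) ^ n * x ^ (n - 2*k)"
      by (subst power_minus) simp
    then show "?c (2*k) = real (n choose (2*k)) * (-1) ^ (n + k) * pi ^ (2*k) * x ^ (n - 2*k)"
      unfolding r by (simp add: power_add)
  qed
  finally show ?thesis .
qed

text \<open>For \<open>n = 0\<close> the sum has the single term \<open>k = 0\<close>, which vanishes because \<open>0 choose 1 = 0\<close>.\<close>

lemma q_poly_altdef:
  "q_poly n x =
     (\<Sum>k\<le>(n - 1) div 2. real (n choose (2*k+1)) * (-1) ^ (n + k + 1) * pi ^ (2*k+1) * x ^ (n - 2*k - 1))"
proof (cases "n = 0")
  case True
  then show ?thesis by (simp add: q_poly_def)
next
  case False
  let ?c = "\<lambda>j. real (n choose j) * Im (\<i> ^ j) * (pi ^ j * (- x) ^ (n - j))"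
  have "q_poly n x = (\<Sum>j\<le>n. ?c j)"
    unfolding q_poly_def ipi_minus_power_expand Im_sum
    by (intro sum.cong refl) simp
  also have "\<dots> = (\<Sum>j\<in>(\<lambda>k. 2*k+1) ` {..(n-1) div 2}. ?c j)"
  proof (rule sum.mono_neutral_right)
    have "Im (\<i> ^ j) = 0" if "j \<le> n" "j \<notin> (\<lambda>k. 2*k+1) ` {..(n-1) div 2}" for j
    proof -
      have "even j"
      proof (rule ccontr)
        assume "odd j"
        then obtain m where "j = 2*m+1" by (elim oddE)
        with that show False by (auto simp: image_iff)
      qed
      then obtain m where "j = 2*m" by (elim evenE)
      then have "\<i> ^ j = of_real ((-1) ^ m)" by (simp add: power_mult)
      then show ?thesis by (simp only: Im_complex_of_real)
    qed
    then show "\<forall>j\<in>{..n} - (\<lambda>k. 2*k+1) ` {..(n-1) div 2}. ?c j = 0" by auto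
    show "(\<lambda>k. 2*k+1) ` {..(n-1) div 2} \<subseteq> {..n}" using False by auto
  qed auto
  also have "\<dots> = (\<Sum>k\<le>(n-1) div 2. ?c (2*k+1))"
    by (subst sum.reindex) (auto simp: inj_on_def)
  also have "\<dots> = (\<Sum>k\<le>(n-1) div 2. real (n choose (2*k+1)) * (-1) ^ (n + k + 1) * pi ^ (2*k+1) * x ^ (n - 2*k - 1))"
  proof (intro sum.cong refl)
    fix k assume "k \<in> {..(n-1) div 2}"
    then have k: "2*k+1 \<le> n" using False by auto
    have "\<i> ^ (2*k+1) = of_real ((-1) ^ k) * \<i>" by (simp add: power_mult)
    then have r: "Im (\<i> ^ (2*k+1)) = (-1) ^ k" by (simp add: Im_i_times)
    obtain m where "n = 2*k + 1 + m" using k le_iff_add by blast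
    then have "(-1::real) ^ (n + 1) = (-1) ^ (n - 2*k - 1)" by (simp add: power_add)
    then have "(- x) ^ (n - (2*k+1)) = (-1) ^ (n + 1) * x ^ (n - 2*k - 1)"
      by (subst power_minus) simp
    then show "?c (2*k+1) = real (n choose (2*k+1)) * (-1) ^ (n + k + 1) * pi ^ (2*k+1) * x ^ (n - 2*k - 1)"
      unfolding r by (simp add: power_add)
  qed
  finally show ?thesis .
qed

end

theory Submission
  imports Defs "HOL-Complex_Analysis.Conformal_Mappings"
begin

text \<open>
  Let \<open>H(g)\<close> be \<open>1 / (2 \<pi> i)\<close> times the integral of \<open>g\<close> over the path coming from \<open>\<infinity> - i\<pi>\<close> to \<open>- i\<pi>\<close>,
  going up to \<open>i\<pi>\<close> and back to \<open>\<infinity> + i\<pi>\<close>. Hankel's formula in the variable \<open>w\<close>, where \<open>u = r e^w\<close>, says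
  that \<open>F(z, r) = H(exp(r e^w - (z - 1) w))\<close> equals \<open>r^(z - 1) / \<Gamma>(z)\<close> for \<open>Re r > 0\<close>. Indeed,
  differentiating under the integral and integrating by parts give \<open>r \<partial>F/\<partial>r = (z - 1) F\<close>, so
  \<open>F = c(z) r^(z - 1)\<close>; for \<open>Re z < 1\<close>, letting \<open>r \<rightarrow> 0\<close> collapses the path onto its two rays and yields
  \<open>c(z) = sin(\<pi> z) \<Gamma>(1 - z) / \<pi> = 1 / \<Gamma>(z)\<close>, and \<open>c\<close> is entire. Inserting this with \<open>r = t / 2\<close> and
  \<open>z = \<nu> + k + 1\<close> into the power series of \<open>J\<^sub>\<nu>\<close> and summing under the integral gives
  \<open>J\<^sub>\<nu>(t) = H(exp(t sinh w - \<nu> w))\<close>, which is differentiated \<open>n\<close> times in \<open>\<nu>\<close>. Folding the path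
  along its symmetry \<open>w \<mapsto> cnj w\<close> produces the two real integrals.
\<close>

section \<open>Integration along the Hankel path\<close>

text \<open>Arc-length parametrisation: \<open>\<bar>s\<bar> \<le> pi\<close> is the vertical
  segment \<open>\<i> * s\<close>, larger \<open>\<bar>s\<bar>\<close> are the two rays. A single
  formula with \<open>max\<close> and \<open>min\<close> makes continuity at the corners
  immediate.\<close>

definition hankel_path :: "real \<Rightarrow> complex" where
  "hankel_path s = Complex (max 0 (\<bar>s\<bar> - pi)) (max (- pi) (min pi s))"

definition hankel_dir :: "real \<Rightarrow> complex" where
  "hankel_dir s = (if s < - pi then - 1 else if s \<le> pi then \<i> else 1)"

definition hankel_integral :: "(complex \<Rightarrow> complex) \<Rightarrow> complex" where
  "hankel_integral g = (\<integral>s. g (hankel_path s) * hankel_dir s \<partial>lborel) / (2 * of_real pi * \<i>)"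

text \<open>
  \<open>hankel_dir\<close> is the derivative of \<open>hankel_path\<close> except at the corners \<open>\<plusminus> pi\<close>, a null set.
\<close>

lemma continuous_hankel_path: "continuous_on A hankel_path"
  unfolding hankel_path_def Complex_eq by (intro continuous_intros)

lemma borel_measurable_hankel_path [measurable]: "hankel_path \<in> borel_measurable borel"
  by (intro borel_measurable_continuous_onI continuous_hankel_path)

lemma borel_measurable_hankel_dir [measurable]: "hankel_dir \<in> borel_measurable borel"
  unfolding hankel_dir_def by measurable

lemma borel_measurable_hankel_integrand [measurable]:
  assumes "continuous_on UNIV g"
  shows "(\<lambda>s. g (hankel_path s) * hankel_dir s) \<in> borel_measurable borel"
proof -
  have [measurable]: "g \<in> borel_measurable borel"
    using assms by (rule borel_measurable_continuous_onI)
  show ?thesis by measurable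
qed

lemma norm_hankel_dir [simp]: "norm (hankel_dir s) = 1"
  by (simp add: hankel_dir_def)

lemma Re_hankel_path_nonneg: "Re (hankel_path s) \<ge> 0"
  by (simp add: hankel_path_def)

lemma norm_hankel_path_le: "norm (hankel_path s) \<le> Re (hankel_path s) + pi"
proof -
  have "norm (hankel_path s) \<le> \<bar>Re (hankel_path s)\<bar> + \<bar>Im (hankel_path s)\<bar>"
    by (rule cmod_le)
  also have "\<bar>Re (hankel_path s)\<bar> = Re (hankel_path s)"
    by (simp add: Re_hankel_path_nonneg)
  also have "\<bar>Im (hankel_path s)\<bar> \<le> pi"
    using pi_gt_zero by (auto simp: hankel_path_def max_def min_def simp del: pi_gt_zero)
  finally show ?thesis by simp
qed

section \<open>Decay and integrability along the path\<close>

lemma integrable_exp_minus_abs: "integrable lborel (\<lambda>s::real. exp (- \<bar>s\<bar>))"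
proof -
  have "set_integrable lebesgue {0..} (\<lambda>x::real. exp (- 1 * x))"
    by (intro nonnegative_absolutely_integrable_1 integrable_on_exp_minus_to_infinity) auto
  then have "integrable lebesgue (\<lambda>x::real. indicator {0..} x *\<^sub>R exp (- x))"
    by (simp add: set_integrable_def)
  then have 1: "integrable lborel (\<lambda>x::real. indicator {0..} x *\<^sub>R exp (- x))"
    by (subst (asm) integrable_completion) auto
  have 2: "integrable lborel (\<lambda>x::real. indicator {0..} (0 + (-1) * x) *\<^sub>R exp (- (0 + (-1) * x)))"
    by (rule lborel_integrable_real_affine[OF 1]) simp
  show ?thesis
    by (rule Bochner_Integration.integrable_bound[OF Bochner_Integration.integrable_add[OF 1 2]])
       (auto simp: indicator_def abs_if)
qed

text \<open>On the rays \<open>exp w\<close> is the negative real \<open>- exp x\<close>, so the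
  first factor decays doubly exponentially and beats any \<open>exp (K * norm w)\<close>. One
  constant serves all \<open>r\<close> in the given region, as differentiation in \<open>r\<close>
  requires.\<close>

lemma hankel_exp_bound:
  assumes "c > 0"
  obtains C where "C \<ge> 0"
    "\<And>r s. Re r \<ge> c \<Longrightarrow> norm r \<le> R \<Longrightarrow>
       norm (exp (r * exp (hankel_path s))) * exp (K * norm (hankel_path s)) \<le> C * exp (- \<bar>s\<bar>)"
proof -
  define K' where "K' = \<bar>K\<bar>"
  \<comment> \<open>The summand \<open>1\<close> in \<open>K' + 1\<close> pays for
    \<open>exp (- \<bar>s\<bar>)\<close>, because \<open>\<bar>s\<bar> \<le> x + pi\<close>. The
    last term is the maximum of \<open>(K' + 1) * x - c * x\<^sup>2 / 2\<close>.\<close>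
  define C where "C = exp (2 * R + (K' + 1) * pi + (K' + 1)\<^sup>2 / (2 * c))"
  have K': "K' \<ge> 0" "K \<le> K'" by (auto simp: K'_def)
  have "norm (exp (r * exp (hankel_path s))) * exp (K * norm (hankel_path s)) \<le> C * exp (- \<bar>s\<bar>)"
    if r: "Re r \<ge> c" "norm r \<le> R" for r s
  proof -
    define w where "w = hankel_path s"
    define x where "x = Re w"
    have x: "x \<ge> 0" "norm w \<le> x + pi" "\<bar>s\<bar> \<le> x + pi"
      using Re_hankel_path_nonneg[of s] norm_hankel_path_le[of s]
      by (auto simp: w_def x_def hankel_path_def)
    have R: "R \<ge> 0" using norm_ge_zero[of r] r(2) by linarith
    \<comment> \<open>On the segment \<open>x = 0\<close> and only the bound \<open>R\<close> is
      available; it is at most \<open>2 * R - c\<close> since \<open>c \<le> R\<close>.\<close>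
    have 1: "Re (r * exp w) \<le> 2 * R - c * exp x"
    proof (cases "\<bar>s\<bar> \<le> pi")
      case True
      then have x0: "x = 0" by (simp add: x_def w_def hankel_path_def)
      have "Re (r * exp w) \<le> norm (r * exp w)" by (rule complex_Re_le_cmod)
      also have "\<dots> \<le> R" using r x0 by (simp add: norm_mult x_def)
      finally have "Re (r * exp w) \<le> R" .
      moreover have "c \<le> R" using r abs_Re_le_cmod[of r] by linarith
      ultimately show ?thesis using x0 by simp
    next
      case False
      then have "w = of_real x + \<i> * of_real pi \<or> w = of_real x - \<i> * of_real pi"
        by (auto simp: x_def w_def hankel_path_def complex_eq_iff)
      then have "exp w = - of_real (exp x)"
        by (auto simp: exp_add exp_diff exp_of_real)
      then have "Re (r * exp w) = - (Re r * exp x)" by simp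
      also have "\<dots> \<le> - (c * exp x)" using r by simp
      finally show ?thesis using R by simp
    qed
    have 2: "exp x \<ge> x\<^sup>2 / 2"
      using exp_lower_Taylor_quadratic[OF x(1)] x by linarith
    have 3: "(K' + 1) * x - c * (x\<^sup>2 / 2) \<le> (K' + 1)\<^sup>2 / (2 * c)"
    proof -
      have "0 \<le> (c * x - (K' + 1))\<^sup>2" by simp
      then show ?thesis using \<open>c > 0\<close>
        by (simp add: field_simps power2_eq_square)
    qed
    have 4: "K * norm w \<le> K' * (x + pi)"
      using K' x by (intro mult_mono) auto
    have 5: "c * (x\<^sup>2 / 2) \<le> c * exp x" using 2 \<open>c > 0\<close> by (intro mult_left_mono) auto
    have "Re (r * exp w) + K * norm w \<le> 2 * R - c * exp x + K' * (x + pi)"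
      using 1 4 by linarith
    also have "\<dots> \<le> 2 * R + (K' + 1) * pi + ((K' + 1) * x - c * (x\<^sup>2 / 2)) - \<bar>s\<bar>"
      using 5 x by (simp add: algebra_simps)
    also have "\<dots> \<le> (2 * R + (K' + 1) * pi + (K' + 1)\<^sup>2 / (2 * c)) + - \<bar>s\<bar>"
      using 3 by linarith
    finally have "exp (Re (r * exp w) + K * norm w) \<le> C * exp (- \<bar>s\<bar>)"
      unfolding C_def exp_add[symmetric] by simp
    then show ?thesis unfolding w_def[symmetric] by (simp only: exp_add norm_exp_eq_Re)
  qed
  then show ?thesis by (intro that[of C]) (auto simp: C_def)
qed

lemma hankel_integrable:
  assumes "continuous_on UNIV g" "\<And>s. norm (g (hankel_path s)) \<le> C * exp (- \<bar>s\<bar>)"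
  shows "integrable lborel (\<lambda>s. g (hankel_path s) * hankel_dir s)"
proof (rule Bochner_Integration.integrable_bound)
  show "integrable lborel (\<lambda>s. C * exp (- \<bar>s::real\<bar>))"
    using integrable_exp_minus_abs by simp
  show "(\<lambda>s. g (hankel_path s) * hankel_dir s) \<in> borel_measurable lborel"
    using borel_measurable_hankel_integrand[OF assms(1)] by simp
  show "AE s in lborel. norm (g (hankel_path s) * hankel_dir s) \<le> norm (C * exp (- \<bar>s\<bar>))"
    using assms(2) by (auto simp: norm_mult intro!: AE_I2 order_trans[OF _ abs_ge_self])
qed

section \<open>Limits and derivatives under the integral sign\<close>

lemma hankel_integral_cmult: "hankel_integral (\<lambda>w. c * g w) = c * hankel_integral g"
  by (simp add: hankel_integral_def mult.assoc)

lemma hankel_integral_tendsto: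
  assumes "\<And>k. continuous_on UNIV (g k)" "continuous_on UNIV h"
    and "\<And>k s. norm (g k (hankel_path s)) \<le> C * exp (- \<bar>s\<bar>)"
    and "\<And>s. (\<lambda>k. g k (hankel_path s)) \<longlonglongrightarrow> h (hankel_path s)"
  shows "(\<lambda>k. hankel_integral (g k)) \<longlonglongrightarrow> hankel_integral h"
  unfolding hankel_integral_def
proof (intro tendsto_intros integral_dominated_convergence[where w = "\<lambda>s. C * exp (- \<bar>s\<bar>)"])
  show "integrable lborel (\<lambda>s. C * exp (- \<bar>s::real\<bar>))"
    using integrable_exp_minus_abs by simp
  show "(\<lambda>s. h (hankel_path s) * hankel_dir s) \<in> borel_measurable lborel"
    "(\<lambda>s. g k (hankel_path s) * hankel_dir s) \<in> borel_measurable lborel" for k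
    using borel_measurable_hankel_integrand assms by simp_all
  show "AE s in lborel. (\<lambda>k. g k (hankel_path s) * hankel_dir s) \<longlonglongrightarrow> h (hankel_path s) * hankel_dir s"
    using assms by (auto intro!: tendsto_intros)
  show "AE s in lborel. norm (g k (hankel_path s) * hankel_dir s) \<le> C * exp (- \<bar>s\<bar>)" for k
    using assms by (auto simp: norm_mult)
qed simp

text \<open>Along any sequence tending to \<open>p0\<close>, the mean value inequality on the convex
  ball bounds the difference quotients by the majorant of \<open>g'\<close>, so dominated
  convergence applies.\<close>

lemma hankel_integral_has_field_derivative:
  assumes "d > 0"
    and cont: "\<And>p. p \<in> ball p0 d \<Longrightarrow> continuous_on UNIV (g p)" "continuous_on UNIV (g' p0)"
    and deriv: "\<And>p w. p \<in> ball p0 d \<Longrightarrow> ((\<lambda>p. g p w) has_field_derivative g' p w) (at p)"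
    and bound: "\<And>p s. p \<in> ball p0 d \<Longrightarrow> norm (g p (hankel_path s)) \<le> B * exp (- \<bar>s\<bar>)"
    and bound': "\<And>p s. p \<in> ball p0 d \<Longrightarrow> norm (g' p (hankel_path s)) \<le> C * exp (- \<bar>s\<bar>)"
  shows "((\<lambda>p. hankel_integral (g p)) has_field_derivative hankel_integral (g' p0)) (at p0)"
  unfolding has_field_derivative_iff tendsto_at_iff_sequentially comp_def
proof (intro allI impI)
  fix X :: "nat \<Rightarrow> complex" assume X: "\<forall>i. X i \<in> UNIV - {p0}" "X \<longlonglongrightarrow> p0"
  then have "eventually (\<lambda>i. X i \<in> ball p0 d) sequentially"
    using \<open>d > 0\<close> by (metis centre_in_ball open_ball topological_tendstoD)
  then obtain N where N: "\<And>i. i \<ge> N \<Longrightarrow> X i \<in> ball p0 d"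
    by (auto simp: eventually_at_top_linorder)
  \<comment> \<open>Dropping the first \<open>N\<close> terms puts the whole sequence inside the
    ball, so that the majorant holds for every index.\<close>
  define q where "q i w = (g (X (i + N)) w - g p0 w) / (X (i + N) - p0)" for i w
  have p0: "p0 \<in> ball p0 d" using \<open>d > 0\<close> by simp
  have XN: "X (i + N) \<in> ball p0 d" "X (i + N) - p0 \<noteq> 0" for i
    using N X by auto
  have "(\<lambda>i. hankel_integral (q i)) \<longlonglongrightarrow> hankel_integral (g' p0)"
  proof (rule hankel_integral_tendsto)
    show "continuous_on UNIV (q i)" for i
      unfolding q_def using XN p0 by (intro continuous_intros cont) auto
    show "norm (q i (hankel_path s)) \<le> C * exp (- \<bar>s\<bar>)" for i s
    proof -
      have "norm (g (X (i + N)) (hankel_path s) - g p0 (hankel_path s)) \<le>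
              C * exp (- \<bar>s\<bar>) * norm (X (i + N) - p0)"
        by (rule field_differentiable_bound[of "ball p0 d" _ "\<lambda>p. g' p (hankel_path s)"])
           (use XN p0 deriv bound' in \<open>auto intro: has_field_derivative_at_within\<close>)
      then show ?thesis using XN by (simp add: q_def norm_divide divide_le_eq)
    qed
    show "(\<lambda>i. q i (hankel_path s)) \<longlonglongrightarrow> g' p0 (hankel_path s)" for s
    proof -
      have "((\<lambda>y. (g y (hankel_path s) - g p0 (hankel_path s)) / (y - p0)) \<longlongrightarrow> g' p0 (hankel_path s)) (at p0)"
        using deriv[OF p0] unfolding has_field_derivative_iff .
      then have "(\<lambda>i. (g (X i) (hankel_path s) - g p0 (hankel_path s)) / (X i - p0)) \<longlonglongrightarrow> g' p0 (hankel_path s)"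
        using X unfolding tendsto_at_iff_sequentially comp_def by blast
      then show ?thesis unfolding q_def by (rule LIMSEQ_ignore_initial_segment)
    qed
  qed (use cont in auto)
  moreover have "hankel_integral (q i) =
      (hankel_integral (g (X (i + N))) - hankel_integral (g p0)) / (X (i + N) - p0)" for i
  proof -
    have "integrable lborel (\<lambda>s. g p (hankel_path s) * hankel_dir s)" if "p \<in> ball p0 d" for p
      using that cont bound by (intro hankel_integrable) auto
    then have "(\<integral>s. q i (hankel_path s) * hankel_dir s \<partial>lborel) =
        ((\<integral>s. g (X (i + N)) (hankel_path s) * hankel_dir s \<partial>lborel) -
         (\<integral>s. g p0 (hankel_path s) * hankel_dir s \<partial>lborel)) / (X (i + N) - p0)"
      using XN(1)[of i] p0 by (simp add: q_def left_diff_distrib)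
    then show ?thesis
      unfolding hankel_integral_def by (simp add: diff_divide_distrib mult.commute)
  qed
  ultimately have "(\<lambda>i. (hankel_integral (g (X (i + N))) - hankel_integral (g p0)) / (X (i + N) - p0))
      \<longlonglongrightarrow> hankel_integral (g' p0)" by simp
  then show "(\<lambda>i. (hankel_integral (g (X i)) - hankel_integral (g p0)) / (X i - p0)) \<longlonglongrightarrow> hankel_integral (g' p0)"
    by (rule LIMSEQ_offset)
qed

section \<open>The fundamental theorem of calculus along the path\<close>

lemma hankel_path_has_vector_derivative:
  assumes "s \<noteq> pi" "s \<noteq> - pi"
  shows "(hankel_path has_vector_derivative hankel_dir s) (at s)"
proof -
  consider "s < - pi" | "- pi < s" "s < pi" | "s > pi" using assms by linarith
  then show ?thesis
  proof cases
    case 1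
    have "((\<lambda>s. - of_real s - of_real pi - \<i> * of_real pi) has_vector_derivative - 1) (at s)"
      by (auto intro!: derivative_eq_intros)
    moreover have "\<bar>y\<bar> = - y" if "y < - pi" for y :: real
      using that pi_gt_zero by linarith
    ultimately have "(hankel_path has_vector_derivative - 1) (at s)"
      by (elim has_vector_derivative_transform_within_open[of _ _ _ "{..<- pi}"])
         (use 1 in \<open>auto simp: hankel_path_def complex_eq_iff\<close>)
    then show ?thesis using 1 by (simp add: hankel_dir_def)
  next
    case 2
    have "((\<lambda>s. \<i> * of_real s) has_vector_derivative \<i>) (at s)"
      by (auto intro!: derivative_eq_intros)
    then have "(hankel_path has_vector_derivative \<i>) (at s)"
      by (rule has_vector_derivative_transform_within_open[of _ _ _ "{- pi<..<pi}"])
         (use 2 in \<open>auto simp: hankel_path_def complex_eq_iff\<close>)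
    then show ?thesis using 2 by (simp add: hankel_dir_def)
  next
    case 3
    have "((\<lambda>s. of_real s - of_real pi + \<i> * of_real pi) has_vector_derivative 1) (at s)"
      by (auto intro!: derivative_eq_intros)
    moreover have "\<bar>y\<bar> = y" if "pi < y" for y :: real
      using that pi_gt_zero by linarith
    ultimately have "(hankel_path has_vector_derivative 1) (at s)"
      by (elim has_vector_derivative_transform_within_open[of _ _ _ "{pi<..}"])
         (use 3 in \<open>auto simp: hankel_path_def complex_eq_iff\<close>)
    then show ?thesis using 3 pi_gt_zero by (simp add: hankel_dir_def del: pi_gt_zero)
  qed
qed

text \<open>The integral over \<open>- k \<le> s \<le> k\<close> is the difference of the values of
  \<open>G\<close> at the end points, which tends to 0 by the decay of \<open>G\<close>. This is the
  source of integration by parts along the path.\<close>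

lemma hankel_integral_derivative_eq_0:
  assumes deriv: "\<And>w. (G has_field_derivative g w) (at w)"
    and cont: "continuous_on UNIV g"
    and G: "\<And>s. norm (G (hankel_path s)) \<le> B * exp (- \<bar>s\<bar>)"
    and g: "\<And>s. norm (g (hankel_path s)) \<le> C * exp (- \<bar>s\<bar>)"
  shows "hankel_integral g = 0"
proof -
  define f where "f s = g (hankel_path s) * hankel_dir s" for s
  have f: "integrable lborel f"
    unfolding f_def by (rule hankel_integrable[OF cont g])
  define I where "I k = (\<integral>s. indicator {- real k..real k} s *\<^sub>R f s \<partial>lborel)" for k
  have "I \<longlonglongrightarrow> (\<integral>s. f s \<partial>lborel)"
    unfolding I_def
  proof (rule integral_dominated_convergence[where w = "\<lambda>s. norm (f s)"])
    show "AE s in lborel. (\<lambda>k. indicator {- real k..real k} s *\<^sub>R f s) \<longlonglongrightarrow> f s"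
    proof (intro AE_I2 tendsto_eventually)
      fix s :: real
      obtain K where "\<bar>s\<bar> \<le> real K" using real_arch_simple by blast
      then have "indicator {- real k..real k} s *\<^sub>R f s = f s" if "k \<ge> K" for k
        using that by (auto simp: indicator_def abs_le_iff)
      then show "\<forall>\<^sub>F k in sequentially. indicator {- real k..real k} s *\<^sub>R f s = f s"
        by (auto simp: eventually_at_top_linorder)
    qed
  qed (use f in \<open>auto simp: indicator_def\<close>)
  moreover have I: "I k = G (hankel_path (real k)) - G (hankel_path (- real k))" for k
  proof -
    have "set_integrable lborel {- real k..real k} f"
      unfolding set_integrable_def by (rule integrable_mult_indicator[OF _ f]) simp
    then have "I k = integral {- real k..real k} f"
      unfolding I_def using set_borel_integral_eq_integral(2)[of "{- real k..real k}" f]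
      by (simp add: set_lebesgue_integral_def)
    \<comment> \<open>The path has corners at \<open>\<plusminus> pi\<close>; finitely many such
      points are harmless as \<open>G\<close> stays continuous along the path.\<close>
    moreover have "(f has_integral (G (hankel_path (real k)) - G (hankel_path (- real k)))) {- real k..real k}"
    proof (rule fundamental_theorem_of_calculus_interior_strong[where S = "{- pi, pi}"])
      fix s assume "s \<in> {- real k<..<real k} - {- pi, pi}"
      then have "((G \<circ> hankel_path) has_vector_derivative (hankel_dir s * g (hankel_path s))) (at s)"
        by (intro field_vector_diff_chain_at hankel_path_has_vector_derivative deriv) auto
      then show "((\<lambda>s. G (hankel_path s)) has_vector_derivative f s) (at s)"
        by (simp add: comp_def f_def mult.commute)
    next
      have "continuous_on UNIV G"
        using deriv DERIV_continuous_on has_field_derivative_at_within by blast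
      then show "continuous_on {- real k..real k} (\<lambda>s. G (hankel_path s))"
        using continuous_on_compose2 continuous_hankel_path by blast
    qed auto
    ultimately show ?thesis by (metis integral_unique)
  qed
  moreover have "I \<longlonglongrightarrow> 0"
  proof (rule Lim_null_comparison[where g = "\<lambda>k. 2 * B * exp (- real k)"])
    show "\<forall>\<^sub>F k in sequentially. norm (I k) \<le> 2 * B * exp (- real k)"
    proof (intro always_eventually allI)
      fix k
      have "norm (I k) \<le> norm (G (hankel_path (real k))) + norm (G (hankel_path (- real k)))"
        unfolding I by (rule norm_triangle_ineq4)
      also have "\<dots> \<le> 2 * B * exp (- real k)"
        using G[of "real k"] G[of "- real k"] by simp
      finally show "norm (I k) \<le> 2 * B * exp (- real k)" .
    qed
    have "(\<lambda>k. exp (- real k)) \<longlonglongrightarrow> 0"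
      by (intro filterlim_compose[OF exp_at_bot] filterlim_compose[OF filterlim_uminus_at_bot_at_top]
            filterlim_real_sequentially)
    then show "(\<lambda>k. 2 * B * exp (- real k)) \<longlonglongrightarrow> 0"
      by (rule tendsto_mult_right_zero)
  qed
  ultimately have "(\<integral>s. f s \<partial>lborel) = 0"
    using LIMSEQ_unique by blast
  then show ?thesis by (simp add: hankel_integral_def f_def)
qed

text \<open>The form of the bound used below: \<open>y\<close> collects the remaining factors of an
  integrand, which grow at most exponentially along the path.\<close>

lemma hankel_exp_mult_bound:
  assumes "c > 0"
  obtains C where
    "\<And>r s y. Re r \<ge> c \<Longrightarrow> norm r \<le> R \<Longrightarrow> norm y \<le> A * exp (K * norm (hankel_path s)) \<Longrightarrow>
       norm (exp (r * exp (hankel_path s)) * y) \<le> C * exp (- \<bar>s\<bar>)"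
proof -
  obtain C where C: "C \<ge> 0"
    "\<And>r s. Re r \<ge> c \<Longrightarrow> norm r \<le> R \<Longrightarrow>
       norm (exp (r * exp (hankel_path s))) * exp (K * norm (hankel_path s)) \<le> C * exp (- \<bar>s\<bar>)"
    using hankel_exp_bound[OF assms] by blast
  have "norm (exp (r * exp (hankel_path s)) * y) \<le> (\<bar>A\<bar> * C) * exp (- \<bar>s\<bar>)"
    if "Re r \<ge> c" "norm r \<le> R" "norm y \<le> A * exp (K * norm (hankel_path s))" for r s y
  proof -
    have "norm (exp (r * exp (hankel_path s)) * y) \<le>
        norm (exp (r * exp (hankel_path s))) * (\<bar>A\<bar> * exp (K * norm (hankel_path s)))"
      unfolding norm_mult using that(3)
      by (intro mult_left_mono) (auto intro: order_trans mult_right_mono)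
    also have "\<dots> = \<bar>A\<bar> * (norm (exp (r * exp (hankel_path s))) * exp (K * norm (hankel_path s)))"
      by simp
    also have "\<dots> \<le> \<bar>A\<bar> * (C * exp (- \<bar>s\<bar>))"
      using C(2)[OF that(1,2)] by (rule mult_left_mono) simp
    finally show ?thesis by simp
  qed
  then show ?thesis using that by blast
qed

lemma norm_exp_mult_le: "norm (exp (a * w)) \<le> exp (norm a * norm w)" for a w :: complex
  using norm_exp[of "a * w"] by (simp add: norm_mult)

lemma hankel_integral_diff:
  assumes "continuous_on UNIV g" "\<And>s. norm (g (hankel_path s)) \<le> B * exp (- \<bar>s\<bar>)"
    and "continuous_on UNIV h" "\<And>s. norm (h (hankel_path s)) \<le> C * exp (- \<bar>s\<bar>)"
  shows "hankel_integral (\<lambda>w. g w - h w) = hankel_integral g - hankel_integral h"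
  using hankel_integrable[OF assms(1,2)] hankel_integrable[OF assms(3,4)]
  by (simp add: hankel_integral_def left_diff_distrib diff_divide_distrib)

text \<open>Reflecting the half \<open>s < 0\<close> pairs conjugate points of the path. The
  direction is \<open>\<i>\<close> at both points of the segment, so the values add; it is
  \<open>1\<close> and \<open>- 1\<close> on the rays, so they subtract.\<close>

lemma hankel_integral_fold:
  assumes "continuous_on UNIV g" "\<And>s. norm (g (hankel_path s)) \<le> C * exp (- \<bar>s\<bar>)"
  defines "seg \<equiv> \<lambda>x::real. g (\<i> * of_real x) + g (- (\<i> * of_real x))"
  defines "ray \<equiv> \<lambda>x::real. g (of_real x + \<i> * of_real pi) - g (of_real x - \<i> * of_real pi)"
  shows "set_integrable lborel {0<..} ray"
    and "hankel_integral g = integral {0..pi} seg / (2 * of_real pi) +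
           (LBINT x:{0<..}. ray x) / (2 * of_real pi * \<i>)"
proof -
  define f where "f s = g (hankel_path s) * hankel_dir s" for s
  have f: "integrable lborel f"
    unfolding f_def by (rule hankel_integrable[OF assms(1,2)])
  then have f': "integrable lborel (\<lambda>s. f (- s))"
    using lborel_integrable_real_affine[of f "-1" 0] by simp
  \<comment> \<open>Writing the shift as \<open>- pi + 1 * s\<close> matches the affine substitution
    that moves the ray to start at 0.\<close>
  have ray: "indicator {0<..} (- pi + 1 * s) *\<^sub>R ray (- pi + 1 * s) = indicator {pi<..} s *\<^sub>R (f s + f (- s))" for s
  proof (cases "s > pi")
    case True
    then have "s > 0" using pi_gt_zero by linarith
    have "hankel_path s = of_real (- pi + s) + \<i> * of_real pi"
      "hankel_path (- s) = of_real (- pi + s) - \<i> * of_real pi"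
      using True \<open>s > 0\<close> by (auto simp: hankel_path_def complex_eq_iff)
    moreover have "\<not> s < - pi" using \<open>s > 0\<close> pi_gt_zero by linarith
    then have "hankel_dir s = 1" "hankel_dir (- s) = - 1"
      using True \<open>s > 0\<close> by (auto simp: hankel_dir_def)
    ultimately show ?thesis using True by (simp add: f_def ray_def)
  qed auto
  have seg: "indicator {0<..pi} s *\<^sub>R (\<i> * seg s) = indicator {0<..pi} s *\<^sub>R (f s + f (- s))" for s
  proof (cases "0 < s \<and> s \<le> pi")
    case True
    have "hankel_path s = \<i> * of_real s" "hankel_path (- s) = - (\<i> * of_real s)"
      using True by (auto simp: hankel_path_def complex_eq_iff)
    moreover have "\<not> s < - pi" using True pi_gt_zero by linarith
    then have "hankel_dir s = \<i>" "hankel_dir (- s) = \<i>"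
      using True by (auto simp: hankel_dir_def)
    ultimately show ?thesis by (simp add: f_def seg_def algebra_simps)
  qed auto
  have int: "integrable lborel (\<lambda>s. indicator A s *\<^sub>R (f s + f (- s)))" if "A \<in> sets borel" for A
    using that f f' by (intro integrable_mult_indicator Bochner_Integration.integrable_add) auto
  have "integrable lborel (\<lambda>s. indicator {0<..} (- pi + 1 * s) *\<^sub>R ray (- pi + 1 * s))"
    unfolding ray by (rule int) simp
  then show ray': "set_integrable lborel {0<..} ray"
    unfolding set_integrable_def by (subst (asm) lborel_integrable_real_affine_iff) auto
  have "integrable lborel (\<lambda>s. indicator {0<..pi} s *\<^sub>R (\<i> * seg s))"
    unfolding seg by (rule int) simp
  then have seg': "set_integrable lborel {0<..pi} (\<lambda>s. \<i> * seg s)"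
    unfolding set_integrable_def .
  \<comment> \<open>Discarding the null point 0 leaves two open half-lines exchanged by
    reflection.\<close>
  have "(\<integral>s. f s \<partial>lborel) = (\<integral>s. indicator {0<..} s *\<^sub>R f s + indicator {..<0} s *\<^sub>R f s \<partial>lborel)"
  proof (rule integral_cong_AE)
    show "AE s in lborel. f s = indicator {0<..} s *\<^sub>R f s + indicator {..<0} s *\<^sub>R f s"
      using AE_lborel_singleton[of "0::real"] by eventually_elim (auto simp: indicator_def)
  qed (use f in auto)
  also have "\<dots> = (\<integral>s. indicator {0<..} s *\<^sub>R f s \<partial>lborel) + (\<integral>s. indicator {..<0} s *\<^sub>R f s \<partial>lborel)"
    using f by (intro Bochner_Integration.integral_add integrable_mult_indicator) auto
  also have "(\<integral>s. indicator {..<0} s *\<^sub>R f s \<partial>lborel) = (\<integral>s. indicator {0<..} s *\<^sub>R f (- s) \<partial>lborel)"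
    by (subst lborel_integral_real_affine[of "-1" _ 0])
       (auto simp: indicator_def intro!: Bochner_Integration.integral_cong)
  also have "(\<integral>s. indicator {0<..} s *\<^sub>R f s \<partial>lborel) + \<dots> = (\<integral>s. indicator {0<..} s *\<^sub>R (f s + f (- s)) \<partial>lborel)"
    unfolding scaleR_add_right
    using f f' by (intro Bochner_Integration.integral_add[symmetric] integrable_mult_indicator) auto
  also have "\<dots> = (\<integral>s. indicator {0<..pi} s *\<^sub>R (f s + f (- s)) + indicator {pi<..} s *\<^sub>R (f s + f (- s)) \<partial>lborel)"
    using less_trans[OF pi_gt_zero] by (intro Bochner_Integration.integral_cong) (auto simp: indicator_def)
  also have "\<dots> = (\<integral>s. indicator {0<..pi} s *\<^sub>R (f s + f (- s)) \<partial>lborel) + (\<integral>s. indicator {pi<..} s *\<^sub>R (f s + f (- s)) \<partial>lborel)"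
    by (intro Bochner_Integration.integral_add int) auto
  also have "(\<integral>s. indicator {pi<..} s *\<^sub>R (f s + f (- s)) \<partial>lborel) = (LBINT x:{0<..}. ray x)"
    unfolding set_lebesgue_integral_def
    by (subst (2) lborel_integral_real_affine[of 1 _ "- pi"]) (simp_all only: ray, auto)
  also have "(\<integral>s. indicator {0<..pi} s *\<^sub>R (f s + f (- s)) \<partial>lborel) = (LBINT s:{0<..pi}. \<i> * seg s)"
    unfolding set_lebesgue_integral_def seg ..
  also have "\<dots> = integral {0<..pi} (\<lambda>s. \<i> * seg s)"
    by (rule set_borel_integral_eq_integral(2)[OF seg'])
  also have "\<dots> = integral {0..pi} (\<lambda>s. \<i> * seg s)"
    by (rule integral_spike_set)
       (rule negligible_subset[OF negligible_sing[of 0]], auto)+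
  also have "\<dots> = \<i> * integral {0..pi} seg"
    by (rule integral_mult_right)
  finally show "hankel_integral g = integral {0..pi} seg / (2 * of_real pi) +
      (LBINT x:{0<..}. ray x) / (2 * of_real pi * \<i>)"
    by (simp add: hankel_integral_def f_def[symmetric] add_divide_distrib)
qed

text \<open>Euler's integral after the substitution \<open>t = exp y\<close>, whose Jacobian raises
  the exponent from \<open>p - 1\<close> to \<open>p\<close>. In the variable \<open>y\<close> a
  rescaling of \<open>t\<close> is a translation.\<close>

lemma Gamma_integral_exp:
  assumes "Re p > 0"
  shows "integrable lborel (\<lambda>y. exp (of_real y * p - of_real (exp y)))"
    and "(\<integral>y. exp (of_real y * p - of_real (exp y)) \<partial>lborel) = Gamma p"
proof -
  define f where "f t = of_real t powr (p - 1) / of_real (exp t)" for t :: real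
  define h where "h y = exp (of_real y * p - of_real (exp y))" for y :: real
  have "exp (of_real y) * exp ((p - 1) * of_real y) = exp (of_real y * p)" for y :: real
    by (simp add: exp_add[symmetric] algebra_simps)
  then have h: "\<bar>exp y\<bar> *\<^sub>R f (exp y) = h y" for y
    by (simp add: f_def h_def powr_def scaleR_conv_of_real exp_of_real[symmetric] exp_diff
        Ln_of_real del: exp_of_real)
  have img: "range (exp :: real \<Rightarrow> real) = {0<..}"
    by (auto simp: image_iff intro: exp_ln[symmetric])
  have "f absolutely_integrable_on exp ` UNIV \<and> integral (exp ` UNIV) f = Gamma p"
    unfolding img f_def
    using absolutely_integrable_Gamma_integral'[OF assms] Gamma_integral_complex'[OF assms]
    by (simp add: integral_unique)
  then have "(\<lambda>y. \<bar>exp y\<bar> *\<^sub>R f (exp y)) absolutely_integrable_on UNIV \<and>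
      integral UNIV (\<lambda>y. \<bar>exp y\<bar> *\<^sub>R f (exp y)) = Gamma p"
    by (subst has_absolute_integral_change_of_variables_real) (auto intro!: derivative_eq_intros inj_onI)
  then have *: "h absolutely_integrable_on UNIV" "integral UNIV h = Gamma p"
    unfolding h by auto
  have "continuous_on UNIV h" unfolding h_def by (intro continuous_intros)
  then have "h \<in> borel_measurable borel" by (rule borel_measurable_continuous_onI)
  then have int: "integrable lborel h"
    using *(1) by (simp add: set_integrable_def integrable_completion)
  then have "(\<integral>y. h y \<partial>lborel) = Gamma p"
    using *(2) by (metis integral_lborel)
  with int show "integrable lborel (\<lambda>y. exp (of_real y * p - of_real (exp y)))"
    "(\<integral>y. exp (of_real y * p - of_real (exp y)) \<partial>lborel) = Gamma p"
    unfolding h_def by auto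
qed

section \<open>Hankel's formula for the reciprocal Gamma function\<close>

definition hankel_F :: "complex \<Rightarrow> complex \<Rightarrow> complex" where
  "hankel_F z r = hankel_integral (\<lambda>w. exp (r * exp w) * exp ((1 - z) * w))"

lemma hankel_F_bound:
  assumes "Re r > 0"
  obtains C where "\<And>s. norm (exp (r * exp (hankel_path s)) * exp (a * hankel_path s)) \<le> C * exp (- \<bar>s\<bar>)"
proof -
  obtain C where
    "\<And>q s y. Re q \<ge> Re r \<Longrightarrow> norm q \<le> norm r \<Longrightarrow> norm y \<le> 1 * exp (norm a * norm (hankel_path s)) \<Longrightarrow>
       norm (exp (q * exp (hankel_path s)) * y) \<le> C * exp (- \<bar>s\<bar>)"
    using hankel_exp_mult_bound[OF assms] by blast
  then show ?thesis using norm_exp_mult_le by (intro that[of C]) auto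
qed

text \<open>Differentiation in \<open>r\<close> brings down a factor \<open>exp w\<close>, which
  turns \<open>1 - z\<close> into \<open>1 - (z - 1)\<close>.\<close>

lemma hankel_F_has_field_derivative_right:
  assumes "Re r > 0"
  shows "((\<lambda>r. hankel_F z r) has_field_derivative hankel_F (z - 1) r) (at r)"
proof -
  \<comment> \<open>With half of \<open>Re r\<close> as radius, the ball stays in
    \<open>Re q \<ge> d\<close>, where the bounds are uniform.\<close>
  define d where "d = Re r / 2"
  have d: "d > 0" using assms by (simp add: d_def)
  have ball: "Re q \<ge> d \<and> norm q \<le> norm r + d" if "q \<in> ball r d" for q
  proof -
    have "norm (q - r) < d" using that by (simp add: dist_norm norm_minus_commute)
    moreover have "\<bar>Re (q - r)\<bar> \<le> norm (q - r)" by (rule abs_Re_le_cmod)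
    moreover have "norm q \<le> norm r + norm (q - r)" by (metis add_diff_cancel_left' add.commute diff_add_cancel norm_triangle_ineq)
    ultimately show ?thesis by (simp add: d_def)
  qed
  have bound: "\<exists>C. \<forall>q\<in>ball r d. \<forall>s.
      norm (exp (q * exp (hankel_path s)) * exp (a * hankel_path s)) \<le> C * exp (- \<bar>s\<bar>)" for a
  proof -
    obtain C where
      "\<And>q s y. Re q \<ge> d \<Longrightarrow> norm q \<le> norm r + d \<Longrightarrow> norm y \<le> 1 * exp (norm a * norm (hankel_path s)) \<Longrightarrow>
         norm (exp (q * exp (hankel_path s)) * y) \<le> C * exp (- \<bar>s\<bar>)"
      using hankel_exp_mult_bound[OF d] by blast
    then show ?thesis using ball norm_exp_mult_le by (metis mult_1)
  qed
  obtain B where B: "\<And>q s. q \<in> ball r d \<Longrightarrow>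
      norm (exp (q * exp (hankel_path s)) * exp ((1 - z) * hankel_path s)) \<le> B * exp (- \<bar>s\<bar>)"
    using bound by blast
  obtain C where C: "\<And>q s. q \<in> ball r d \<Longrightarrow>
      norm (exp (q * exp (hankel_path s)) * exp ((1 - (z - 1)) * hankel_path s)) \<le> C * exp (- \<bar>s\<bar>)"
    using bound by blast
  show ?thesis
    unfolding hankel_F_def
  proof (rule hankel_integral_has_field_derivative[OF d _ _ _ B C])
    show "((\<lambda>q. exp (q * exp w) * exp ((1 - z) * w)) has_field_derivative
            exp (p * exp w) * exp ((1 - (z - 1)) * w)) (at p)" for p w
      by (auto intro!: derivative_eq_intros simp: exp_add[symmetric] algebra_simps)
  qed (auto intro!: continuous_intros)
qed

text \<open>Holomorphy in \<open>z\<close> at fixed \<open>r\<close>, for the analytic continuation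
  of Hankel's formula to all \<open>z\<close>.\<close>

lemma hankel_F_has_field_derivative_left:
  assumes "Re r > 0"
  shows "(\<lambda>z. hankel_F z r) field_differentiable (at z)"
proof -
  have ball: "norm (1 - q) \<le> norm (1 - z) + 1" if "q \<in> ball z 1" for q
  proof -
    have "norm (z - q) < 1" using that by (simp add: dist_norm)
    moreover have "norm (1 - q) \<le> norm (1 - z) + norm (z - q)"
      using norm_triangle_ineq[of "1 - z" "z - q"] by simp
    ultimately show ?thesis by simp
  qed
  have ex: "norm (exp ((1 - q) * w)) \<le> exp ((norm (1 - z) + 1) * norm w)" if "q \<in> ball z 1" for q w
    by (rule order_trans[OF norm_exp_mult_le]) (use ball[OF that] in \<open>auto intro: mult_right_mono\<close>)
  obtain B where B:
    "\<And>q s y. Re q \<ge> Re r \<Longrightarrow> norm q \<le> norm r \<Longrightarrow> norm y \<le> 1 * exp ((norm (1 - z) + 1) * norm (hankel_path s)) \<Longrightarrow>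
       norm (exp (q * exp (hankel_path s)) * y) \<le> B * exp (- \<bar>s\<bar>)"
    using hankel_exp_mult_bound[OF assms] by blast
  obtain C where C:
    "\<And>q s y. Re q \<ge> Re r \<Longrightarrow> norm q \<le> norm r \<Longrightarrow> norm y \<le> 1 * exp ((norm (1 - z) + 2) * norm (hankel_path s)) \<Longrightarrow>
       norm (exp (q * exp (hankel_path s)) * y) \<le> C * exp (- \<bar>s\<bar>)"
    using hankel_exp_mult_bound[OF assms] by blast
  \<comment> \<open>The factor \<open>- w\<close> is absorbed by
    \<open>norm w \<le> exp (norm w)\<close>, hence \<open>2\<close> in place of \<open>1\<close> in
    the exponent.\<close>
  have ex': "norm (- w * exp ((1 - q) * w)) \<le> exp ((norm (1 - z) + 2) * norm w)" if "q \<in> ball z 1" for q w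
  proof -
    have "norm (- w * exp ((1 - q) * w)) \<le> exp (norm w) * exp ((norm (1 - z) + 1) * norm w)"
    proof -
      have "norm (- w) \<le> exp (norm w)"
        unfolding norm_minus_cancel using exp_ge_add_one_self[of "norm w"] by linarith
      then show ?thesis
        unfolding norm_mult[of "- w"] by (intro mult_mono ex that) auto
    qed
    also have "\<dots> = exp ((norm (1 - z) + 2) * norm w)"
      by (simp add: exp_add[symmetric] algebra_simps)
    finally show ?thesis .
  qed
  have "((\<lambda>z. hankel_F z r) has_field_derivative
      hankel_integral (\<lambda>w. exp (r * exp w) * (- w * exp ((1 - z) * w)))) (at z)"
    unfolding hankel_F_def
  proof (rule hankel_integral_has_field_derivative[OF zero_less_one])
    show "((\<lambda>q. exp (r * exp w) * exp ((1 - q) * w)) has_field_derivative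
            exp (r * exp w) * (- w * exp ((1 - p) * w))) (at p)" for p w
      by (auto intro!: derivative_eq_intros)
  next
    fix q s assume q: "q \<in> ball z 1"
    show "norm (exp (r * exp (hankel_path s)) * exp ((1 - q) * hankel_path s)) \<le> B * exp (- \<bar>s\<bar>)"
      using ex[OF q] by (intro B) simp_all
    show "norm (exp (r * exp (hankel_path s)) * (- hankel_path s * exp ((1 - q) * hankel_path s))) \<le> C * exp (- \<bar>s\<bar>)"
      using ex'[OF q] by (intro C) (simp_all only: mult_1 order_refl)
  qed (auto intro!: continuous_intros)
  then show ?thesis by (auto simp: field_differentiable_def)
qed

text \<open>Integration by parts: the integrand \<open>G\<close> for \<open>z\<close> has derivative
  \<open>r * H w - (z - 1) * G w\<close>, where \<open>H\<close> is the integrand for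
  \<open>z - 1\<close>, and the integral of a derivative vanishes.\<close>

lemma hankel_F_recurrence:
  assumes "Re r > 0"
  shows "r * hankel_F (z - 1) r = (z - 1) * hankel_F z r"
proof -
  define G where "G w = exp (r * exp w) * exp ((1 - z) * w)" for w
  define H where "H w = exp (r * exp w) * exp ((1 - (z - 1)) * w)" for w
  obtain B where B: "\<And>s. norm (G (hankel_path s)) \<le> B * exp (- \<bar>s\<bar>)"
    unfolding G_def using hankel_F_bound[OF assms] by blast
  obtain C where C: "\<And>s. norm (H (hankel_path s)) \<le> C * exp (- \<bar>s\<bar>)"
    unfolding H_def using hankel_F_bound[OF assms] by blast
  have cont: "continuous_on UNIV G" "continuous_on UNIV H"
    unfolding G_def H_def by (intro continuous_intros)+
  have bG: "norm ((z - 1) * G (hankel_path s)) \<le> (norm (z - 1) * B) * exp (- \<bar>s\<bar>)" for s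
    using mult_left_mono[OF B[of s], of "norm (z - 1)"] by (simp add: norm_mult)
  have bH: "norm (r * H (hankel_path s)) \<le> (norm r * C) * exp (- \<bar>s\<bar>)" for s
    using mult_left_mono[OF C[of s], of "norm r"] by (simp add: norm_mult)
  have cont': "continuous_on UNIV (\<lambda>w. (z - 1) * G w)" "continuous_on UNIV (\<lambda>w. r * H w)"
    using cont by (auto intro!: continuous_intros)
  have "hankel_integral (\<lambda>w. r * H w - (z - 1) * G w) = 0"
  proof (rule hankel_integral_derivative_eq_0[OF _ _ B])
    have "exp ((1 - (z - 1)) * w) = exp w * exp ((1 - z) * w)" for w
      by (simp add: exp_add[symmetric] algebra_simps)
    then show "(G has_field_derivative r * H w - (z - 1) * G w) (at w)" for w
      unfolding G_def H_def by (auto intro!: derivative_eq_intros simp: algebra_simps)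
    show "norm (r * H (hankel_path s) - (z - 1) * G (hankel_path s)) \<le>
        (norm r * C + norm (z - 1) * B) * exp (- \<bar>s\<bar>)" for s
      using norm_triangle_ineq4[of "r * H (hankel_path s)" "(z - 1) * G (hankel_path s)"] bG[of s] bH[of s]
      by (simp add: distrib_right)
  qed (use cont' in \<open>auto intro!: continuous_intros\<close>)
  then have "hankel_integral (\<lambda>w. r * H w) = hankel_integral (\<lambda>w. (z - 1) * G w)"
    using hankel_integral_diff[OF cont'(2) bH cont'(1) bG] by simp
  then show ?thesis by (simp add: hankel_integral_cmult hankel_F_def G_def H_def)
qed

text \<open>By the recurrence \<open>\<Phi>\<close> has derivative zero on the right half-plane,
  which is convex and avoids the branch cut of \<open>powr\<close>; hence it is constant
  there.\<close>

lemma hankel_F_conv_hankel_F_1: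
  assumes "Re r > 0"
  shows "hankel_F z r * r powr (1 - z) = hankel_F z 1"
proof -
  define \<Phi> where "\<Phi> r = hankel_F z r * r powr (1 - z)" for r
  have "(\<Phi> has_field_derivative 0) (at q within {q. Re q > 0})" if "q \<in> {q. Re q > 0}" for q
  proof -
    have q: "Re q > 0" using that by simp
    then have "q \<notin> \<real>\<^sub>\<le>\<^sub>0" "q \<noteq> 0" by (auto simp: complex_nonpos_Reals_iff)
    have "(\<Phi> has_field_derivative
        (hankel_F (z - 1) q * q powr (1 - z) + hankel_F z q * ((1 - z) * q powr (1 - z - 1)))) (at q)"
      unfolding \<Phi>_def
      using \<open>q \<notin> \<real>\<^sub>\<le>\<^sub>0\<close> hankel_F_has_field_derivative_right[OF q, of z]
      by (auto intro!: derivative_eq_intros simp: algebra_simps)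
    also have "hankel_F (z - 1) q * q powr (1 - z) + hankel_F z q * ((1 - z) * q powr (1 - z - 1)) =
        (q * hankel_F (z - 1) q - (z - 1) * hankel_F z q) * q powr (1 - z - 1)"
      using powr_diff[of q "1 - z" 1] \<open>q \<noteq> 0\<close> by (simp add: field_simps)
    also have "\<dots> = 0" using hankel_F_recurrence[OF q, of z] by simp
    finally show ?thesis by (rule has_field_derivative_at_within)
  qed
  then obtain c where "\<And>q. q \<in> {q. Re q > 0} \<Longrightarrow> \<Phi> q = c"
    using has_field_derivative_zero_constant[OF convex_halfspace_Re_gt] by metis
  then have "\<Phi> r = \<Phi> 1" using assms by simp
  then show ?thesis by (simp add: \<Phi>_def)
qed

lemma hankel_F_1_left_half_plane:
  assumes z: "Re z < 1"
  shows "hankel_F z 1 = rGamma z"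
proof -
  \<comment> \<open>The limit \<open>r \<rightarrow> 0\<close> is taken along
    \<open>exp (- m)\<close>: then \<open>r m powr (1 - z)\<close> is the explicit exponential
    \<open>f m\<close>, and rescaling on the rays is a translation by \<open>m\<close>.\<close>
  define r where "r m = exp (- real m)" for m :: nat
  have r: "r m > 0" "r m \<le> 1" for m by (auto simp: r_def)
  define g where "g m w = exp (of_real (r m) * exp w) * exp ((1 - z) * w)" for m w
  define seg where "seg m x = g m (\<i> * of_real x) + g m (- (\<i> * of_real x))" for m and x :: real
  define ray where "ray m x = g m (of_real x + \<i> * of_real pi) - g m (of_real x - \<i> * of_real pi)" for m and x :: real
  define f where "f m = exp (- (of_real (real m) * (1 - z)))" for m :: nat
  define h where "h y = exp (of_real y * (1 - z) - of_real (exp y))" for y :: real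
  have Re1z: "Re (1 - z) > 0" using z by simp
  note h = Gamma_integral_exp[OF Re1z, folded h_def]

  have eq: "hankel_F z 1 = f m * (integral {0..pi} (seg m) / (2 * of_real pi)) +
      f m * ((LBINT x:{0<..}. ray m x) / (2 * of_real pi * \<i>))" for m
  proof -
    have rm: "Re (of_real (r m)) > 0" using r by simp
    have "of_real (r m) powr (1 - z) = f m"
      by (simp add: powr_def r_def f_def Ln_of_real mult.commute flip: exp_of_real)
    moreover obtain C where "\<And>s. norm (g m (hankel_path s)) \<le> C * exp (- \<bar>s\<bar>)"
      unfolding g_def using hankel_F_bound[OF rm] by blast
    moreover have "continuous_on UNIV (g m)"
      unfolding g_def by (intro continuous_intros)
    ultimately have "hankel_F z 1 = f m * hankel_integral (g m)"
        "hankel_integral (g m) = integral {0..pi} (seg m) / (2 * of_real pi) +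
           (LBINT x:{0<..}. ray m x) / (2 * of_real pi * \<i>)"
      using hankel_F_conv_hankel_F_1[OF rm, of z] hankel_integral_fold(2)[of "g m" C]
      unfolding hankel_F_def g_def[abs_def] seg_def[abs_def] ray_def[abs_def]
      by (simp_all add: mult.commute)
    then show ?thesis by (simp only: distrib_left)
  qed

  \<comment> \<open>On the segment \<open>g m\<close> is bounded uniformly in \<open>m\<close>
    because \<open>r m \<le> 1\<close>, and \<open>f m\<close> tends to 0 because
    \<open>Re z < 1\<close>.\<close>
  have "(\<lambda>m. f m * (integral {0..pi} (seg m) / (2 * of_real pi))) \<longlonglongrightarrow> 0"
  proof (rule Lim_null_comparison[where g = "\<lambda>m. exp (- (real m * (1 - Re z))) * (exp (1 + norm (1 - z) * pi))"])
    show "\<forall>\<^sub>F m in sequentially. norm (f m * (integral {0..pi} (seg m) / (2 * of_real pi))) \<le>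
        exp (- (real m * (1 - Re z))) * (exp (1 + norm (1 - z) * pi))"
    proof (intro always_eventually allI)
      fix m
      have g: "norm (g m w) \<le> exp (1 + norm (1 - z) * pi)" if "Re w = 0" "norm w \<le> pi" for w
      proof -
        have "norm (exp (of_real (r m) * exp w)) \<le> exp 1"
          by (rule order_trans[OF norm_exp_mult_le]) (use r[of m] that in \<open>simp add: less_imp_le\<close>)
        moreover have "norm (exp ((1 - z) * w)) \<le> exp (norm (1 - z) * pi)"
          by (rule order_trans[OF norm_exp_mult_le]) (use that in \<open>auto intro: mult_left_mono\<close>)
        ultimately show ?thesis
          unfolding g_def exp_add norm_mult by (intro mult_mono) auto
      qed
      have "norm (seg m x) \<le> 2 * exp (1 + norm (1 - z) * pi)" if "x \<in> {0..pi}" for x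
        using norm_triangle_ineq[of "g m (\<i> * of_real x)" "g m (- (\<i> * of_real x))"]
          g[of "\<i> * of_real x"] g[of "- (\<i> * of_real x)"] that
        by (simp add: seg_def norm_mult)
      moreover have "continuous_on {0..pi} (seg m)"
        unfolding seg_def g_def by (intro continuous_intros)
      ultimately have "norm (integral {0..pi} (seg m)) \<le> 2 * exp (1 + norm (1 - z) * pi) * (pi - 0)"
        by (intro integral_bound) auto
      then have "norm (integral {0..pi} (seg m) / (2 * of_real pi)) \<le> exp (1 + norm (1 - z) * pi)"
        by (simp add: norm_divide norm_mult divide_le_eq)
      moreover have "norm (f m) = exp (- (real m * (1 - Re z)))"
        by (simp add: f_def norm_exp_eq_Re)
      ultimately show "norm (f m * (integral {0..pi} (seg m) / (2 * of_real pi))) \<le>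
        exp (- (real m * (1 - Re z))) * (exp (1 + norm (1 - z) * pi))"
        unfolding norm_mult by simp
    qed
    have "filterlim (\<lambda>m. (1 - Re z) * real m) at_top sequentially"
      using z by (intro filterlim_tendsto_pos_mult_at_top[OF tendsto_const] filterlim_real_sequentially) auto
    then have "(\<lambda>m. exp (- ((1 - Re z) * real m))) \<longlonglongrightarrow> 0"
      by (intro filterlim_compose[OF exp_at_bot] filterlim_compose[OF filterlim_uminus_at_bot_at_top])
    then show "(\<lambda>m. exp (- (real m * (1 - Re z))) * (exp (1 + norm (1 - z) * pi))) \<longlonglongrightarrow> 0"
      by (intro tendsto_mult_left_zero) (simp add: mult.commute)
  qed
  \<comment> \<open>After translation the rays contribute the integral of \<open>h\<close> over
    \<open>y > - m\<close>, and these half-lines exhaust the real line.\<close>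
  moreover have "(\<lambda>m. f m * ((LBINT x:{0<..}. ray m x) / (2 * of_real pi * \<i>))) \<longlonglongrightarrow>
      sin (of_real pi * z) / of_real pi * Gamma (1 - z)"
  proof -
    define I where "I m = (\<integral>y. indicator {- real m<..} y *\<^sub>R h y \<partial>lborel)" for m
    have "I \<longlonglongrightarrow> (\<integral>y. h y \<partial>lborel)"
      unfolding I_def
    proof (rule integral_dominated_convergence[where w = "\<lambda>y. norm (h y)"])
      show "AE y in lborel. (\<lambda>m. indicator {- real m<..} y *\<^sub>R h y) \<longlonglongrightarrow> h y"
      proof (intro AE_I2 tendsto_eventually)
        fix y :: real
        obtain K where "- y < real K" using reals_Archimedean2 by blast
        then have "indicator {- real m<..} y *\<^sub>R h y = h y" if "m \<ge> K" for m
          using that by (auto simp: indicator_def)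
        then show "\<forall>\<^sub>F m in sequentially. indicator {- real m<..} y *\<^sub>R h y = h y"
          by (auto simp: eventually_at_top_linorder)
      qed
    qed (use h in \<open>auto simp: indicator_def\<close>)
    then have "(\<lambda>m. sin (of_real pi * z) / of_real pi * I m) \<longlonglongrightarrow> sin (of_real pi * z) / of_real pi * Gamma (1 - z)"
      unfolding h(2) by (intro tendsto_intros)
    moreover have "f m * ((LBINT x:{0<..}. ray m x) / (2 * of_real pi * \<i>)) = sin (of_real pi * z) / of_real pi * I m" for m
    proof -
      \<comment> \<open>Both rays carry the same decaying factor \<open>E\<close>, since
        \<open>exp w\<close> is the same there; the difference of the phases from
        \<open>exp (- z * w)\<close> produces the sine.\<close>
      have ray: "f m * ray m x = 2 * \<i> * sin (of_real pi * z) * h (- real m + 1 * x)" for x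
      proof -
        define E where "E = exp (of_real x * (1 - z) - of_real (r m * exp x))"
        have "g m (of_real x + \<i> * of_real pi) = - E * exp (- (\<i> * (of_real pi * z)))"
          "g m (of_real x - \<i> * of_real pi) = - E * exp (\<i> * (of_real pi * z))"
          unfolding g_def E_def
          by (simp_all add: exp_add exp_diff ring_distribs exp_minus field_simps flip: exp_of_real)
        then have "ray m x = E * (exp (\<i> * (of_real pi * z)) - exp (- (\<i> * (of_real pi * z))))"
          by (simp add: ray_def algebra_simps)
        also have "\<dots> = 2 * \<i> * sin (of_real pi * z) * E"
          by (simp add: sin_exp_eq field_simps)
        also have "f m * \<dots> = 2 * \<i> * sin (of_real pi * z) * (f m * E)" by simp
        also have "f m * E = h (- real m + 1 * x)"
          by (simp add: f_def E_def h_def r_def exp_add[symmetric] algebra_simps flip: exp_of_real)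
        finally show ?thesis .
      qed
      have "f m * (LBINT x:{0<..}. ray m x) = (LBINT x:{0<..}. f m * ray m x)"
        by simp
      also have "\<dots> = 2 * \<i> * sin (of_real pi * z) * (LBINT x:{0<..}. h (- real m + 1 * x))"
        unfolding ray by simp
      also have "(LBINT x:{0<..}. h (- real m + 1 * x)) = I m"
        unfolding I_def set_lebesgue_integral_def
        by (subst (2) lborel_integral_real_affine[of 1 _ "- real m"])
           (auto simp: indicator_def intro!: Bochner_Integration.integral_cong)
      finally show ?thesis by (simp add: field_simps)
    qed
    ultimately show ?thesis by simp
  qed
  ultimately have "(\<lambda>m::nat. hankel_F z 1) \<longlonglongrightarrow> 0 + sin (of_real pi * z) / of_real pi * Gamma (1 - z)"
    by (subst tendsto_cong[OF always_eventually, OF allI, OF eq]) (rule tendsto_add)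
  then have "hankel_F z 1 = sin (of_real pi * z) / of_real pi * Gamma (1 - z)"
    by (simp add: LIMSEQ_const_iff)
  \<comment> \<open>The reflection formula writes the sine quotient as
    \<open>rGamma z * rGamma (1 - z)\<close>. The last two factors cancel because
    \<open>Re (1 - z) > 0\<close> excludes the poles.\<close>
  also have "\<dots> = rGamma z * (rGamma (1 - z) * Gamma (1 - z))"
    by (simp add: rGamma_reflection_complex[symmetric])
  also have "rGamma (1 - z) * Gamma (1 - z) = 1"
  proof -
    have "1 - z \<notin> \<int>\<^sub>\<le>\<^sub>0" using z by (auto elim!: nonpos_Ints_cases simp: complex_eq_iff)
    then show ?thesis by (simp add: Gamma_def rGamma_eq_zero_iff)
  qed
  finally show ?thesis by simp
qed

text \<open>Both \<open>hankel_F z 1\<close> and \<open>rGamma z\<close> are entire in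
  \<open>z\<close>, so their equality extends from \<open>Re z < 1\<close> to the plane; the
  dependence on \<open>r\<close> is already known.\<close>

lemma hankel_F_eq:
  assumes "Re r > 0"
  shows "hankel_F z r = rGamma z * r powr (z - 1)"
proof -
  have "hankel_F z 1 = rGamma z"
  proof (rule analytic_continuation_open[of "{z. Re z < 1}" UNIV "\<lambda>z. hankel_F z 1" rGamma])
    show "open {z. Re z < 1}" by (rule open_halfspace_Re_lt)
    show "{z. Re z < 1} \<noteq> {}" by (auto intro: exI[of _ 0])
    show "(\<lambda>z. hankel_F z 1) holomorphic_on UNIV"
      using hankel_F_has_field_derivative_left[of 1] by (auto simp: holomorphic_on_def intro: field_differentiable_at_within)
  qed (auto intro: hankel_F_1_left_half_plane holomorphic_rGamma)
  moreover have "r \<noteq> 0" using assms by auto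
  then have "r powr (1 - z) * r powr (z - 1) = 1"
    by (simp flip: powr_add)
  ultimately show ?thesis using hankel_F_conv_hankel_F_1[OF assms, of z]
    by (metis mult.assoc mult.right_neutral)
qed

section \<open>The Bessel function\<close>

text \<open>Gives a majorant independent of \<open>N\<close> for the partial sums when the Bessel
  series is summed under the integral.\<close>

lemma sum_power_fact_le_exp:
  assumes "(x::real) \<ge> 0"
  shows "(\<Sum>k<N. x ^ k /\<^sub>R fact k) \<le> exp x"
proof -
  have "(\<lambda>k. x ^ k /\<^sub>R fact k) sums exp x" by (rule exp_converges)
  then show ?thesis
    using sum_le_suminf[of "\<lambda>k. x ^ k /\<^sub>R fact k" "{..<N}"] assms by (simp add: sums_iff)
qed

text \<open>Absorbs the factor \<open>(- w) ^ n\<close> from \<open>n\<close> differentiations in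
  the order into one exponential.\<close>

lemma power_le_fact_mult_exp:
  assumes "(x::real) \<ge> 0"
  shows "x ^ n \<le> fact n * exp x"
proof -
  have "x ^ n /\<^sub>R fact n \<le> (\<Sum>k<Suc n. x ^ k /\<^sub>R fact k)"
    using assms by (intro member_le_sum) auto
  also have "\<dots> \<le> exp x" using assms by (rule sum_power_fact_le_exp)
  finally show ?thesis by (simp add: field_simps)
qed

lemma norm_exp_minus_hankel_path_le: "norm (exp (- hankel_path s)) \<le> 1"
  using Re_hankel_path_nonneg[of s] by (simp add: norm_exp_eq_Re)

lemma hankel_integral_sum:
  assumes "\<And>k. k \<in> I \<Longrightarrow> continuous_on UNIV (g k)"
    and "\<And>k s. k \<in> I \<Longrightarrow> norm (g k (hankel_path s)) \<le> B k * exp (- \<bar>s\<bar>)"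
  shows "hankel_integral (\<lambda>w. \<Sum>k\<in>I. g k w) = (\<Sum>k\<in>I. hankel_integral (g k))"
proof -
  have "integrable lborel (\<lambda>s. g k (hankel_path s) * hankel_dir s)" if "k \<in> I" for k
    using assms that by (intro hankel_integrable) auto
  then show ?thesis
    by (simp add: hankel_integral_def sum_distrib_right sum_divide_distrib)
qed

text \<open>The \<open>n\<close>-th derivative in \<open>\<nu>\<close> of
  \<open>exp (t * sinh w - \<nu> * w)\<close>, so that differentiating only raises
  \<open>n\<close>.\<close>

definition bessel_kernel :: "complex \<Rightarrow> nat \<Rightarrow> complex \<Rightarrow> complex \<Rightarrow> complex" where
  "bessel_kernel t n \<nu> w = (- w) ^ n * exp (t * sinh w - \<nu> * w)"

text \<open>Separates the factor with doubly exponential decay from factors of at most exponential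
  growth along the path.\<close>

lemma bessel_kernel_altdef:
  "bessel_kernel t n \<nu> w =
     exp (t / 2 * exp w) * (exp (- (t / 2) * exp (- w)) * ((- w) ^ n * exp (- \<nu> * w)))"
proof -
  have "exp (t * sinh w - \<nu> * w) = exp (t / 2 * exp w) * (exp (- (t / 2) * exp (- w)) * exp (- \<nu> * w))"
    unfolding exp_add[symmetric] by (simp add: sinh_field_def field_simps)
  then show ?thesis by (simp add: bessel_kernel_def)
qed

lemma continuous_bessel_kernel: "continuous_on A (bessel_kernel t n \<nu>)"
  unfolding bessel_kernel_altdef by (intro continuous_intros)

lemma bessel_kernel_bound:
  assumes "Re t > 0"
  obtains C where
    "\<And>\<nu> s. norm \<nu> \<le> R \<Longrightarrow> norm (bessel_kernel t n \<nu> (hankel_path s)) \<le> C * exp (- \<bar>s\<bar>)"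
proof -
  have t: "Re (t / 2) > 0" using assms by simp
  \<comment> \<open>The factor with \<open>exp (- w)\<close> is at most
    \<open>exp (norm (t / 2))\<close>, since \<open>Re w \<ge> 0\<close> on the path;
    \<open>fact n\<close> and the \<open>1\<close> in \<open>1 + R\<close> come from
    \<open>(- w) ^ n\<close>.\<close>
  obtain C where C:
    "\<And>r s y. Re r \<ge> Re (t / 2) \<Longrightarrow> norm r \<le> norm (t / 2) \<Longrightarrow>
       norm y \<le> (exp (norm (t / 2)) * fact n) * exp ((1 + R) * norm (hankel_path s)) \<Longrightarrow>
       norm (exp (r * exp (hankel_path s)) * y) \<le> C * exp (- \<bar>s\<bar>)"
    using hankel_exp_mult_bound[OF t] by blast
  have "norm (bessel_kernel t n \<nu> (hankel_path s)) \<le> C * exp (- \<bar>s\<bar>)" if \<nu>: "norm \<nu> \<le> R" for \<nu> s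
    unfolding bessel_kernel_altdef
  proof (rule C)
    define w where "w = hankel_path s"
    have 1: "norm (exp (- (t / 2) * exp (- w))) \<le> exp (norm (t / 2))"
      using norm_exp_minus_hankel_path_le[of s]
      by (intro order_trans[OF norm_exp_mult_le]) (simp add: w_def mult_left_le)
    have 2: "norm ((- w) ^ n) \<le> fact n * exp (norm w)"
      by (simp add: norm_power power_le_fact_mult_exp)
    have 3: "norm (exp (- \<nu> * w)) \<le> exp (R * norm w)"
      by (rule order_trans[OF norm_exp_mult_le]) (use \<nu> in \<open>auto intro: mult_right_mono\<close>)
    have "norm (exp (- (t / 2) * exp (- w)) * ((- w) ^ n * exp (- \<nu> * w)))
        \<le> exp (norm (t / 2)) * ((fact n * exp (norm w)) * exp (R * norm w))"
      unfolding norm_mult[of "exp _"] norm_mult[of "(- w) ^ n"]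
      by (intro mult_mono 1 2 3) auto
    also have "\<dots> = (exp (norm (t / 2)) * fact n) * exp ((1 + R) * norm w)"
      by (simp add: exp_add distrib_right)
    finally show "norm (exp (- (t / 2) * exp (- hankel_path s)) *
        ((- hankel_path s) ^ n * exp (- \<nu> * hankel_path s)))
        \<le> (exp (norm (t / 2)) * fact n) * exp ((1 + R) * norm (hankel_path s))"
      unfolding w_def .
  qed auto
  then show ?thesis using that by blast
qed

text \<open>Hankel's formula with \<open>z = k + \<nu> + 1\<close> turns each term of the series
  into an integral; the integrands then sum to the kernel by the exponential series of
  \<open>- r * exp (- w)\<close>.\<close>

lemma Bessel_J_eq_hankel_integral:
  assumes "Re t > 0"
  shows "Bessel_J \<nu> t = hankel_integral (bessel_kernel t 0 \<nu>)"
proof -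
  define r where "r = t / 2"
  have r: "Re r > 0" "r \<noteq> 0" using assms by (auto simp: r_def)
  define g where "g k w = ((- r) ^ k /\<^sub>R fact k) * (exp (r * exp w) * exp ((1 - (of_nat k + \<nu> + 1)) * w))" for k w
  have g: "g k w = exp (r * exp w) * (((- r * exp (- w)) ^ k /\<^sub>R fact k) * exp (- \<nu> * w))" for k w
  proof -
    have "exp ((1 - (of_nat k + \<nu> + 1)) * w) = exp (- w) ^ k * exp (- \<nu> * w)"
      by (simp add: exp_of_nat_mult[symmetric] exp_add[symmetric] algebra_simps)
    moreover have "(- r * exp (- w)) ^ k = (- r) ^ k * exp (- w) ^ k"
      by (rule power_mult_distrib)
    ultimately show ?thesis by (simp add: g_def scaleR_conv_of_real)
  qed
  have cont: "continuous_on UNIV (g k)" for k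
    unfolding g_def by (intro continuous_intros)
  \<comment> \<open>These bounds depend on \<open>k\<close> and serve only to integrate finite sums
    termwise; the partial sums get a common majorant below.\<close>
  have "\<exists>B. \<forall>s. norm (g k (hankel_path s)) \<le> B * exp (- \<bar>s\<bar>)" for k
  proof -
    obtain C where C: "\<And>s. norm (exp (r * exp (hankel_path s)) * exp ((1 - (of_nat k + \<nu> + 1)) * hankel_path s))
        \<le> C * exp (- \<bar>s\<bar>)"
      using hankel_F_bound[OF r(1)] by blast
    have "norm (g k (hankel_path s)) \<le> (norm ((- r) ^ k /\<^sub>R fact k) * C) * exp (- \<bar>s\<bar>)" for s
      using mult_left_mono[OF C[of s] norm_ge_zero[of "(- r) ^ k /\<^sub>R fact k"]]
      unfolding g_def norm_mult[of "(- r) ^ k /\<^sub>R fact k"] by (simp only: mult.assoc)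
    then show ?thesis by blast
  qed
  then obtain B where B: "\<And>k s. norm (g k (hankel_path s)) \<le> B k * exp (- \<bar>s\<bar>)"
    by metis
  have int_g: "hankel_integral (g k) =
      (-1) ^ k / fact k * rGamma (of_nat k + \<nu> + 1) * r powr (2 * of_nat k + \<nu>)" for k
  proof -
    have "hankel_integral (g k) = ((- r) ^ k /\<^sub>R fact k) * (rGamma (of_nat k + \<nu> + 1) * r powr (of_nat k + \<nu>))"
      using hankel_F_eq[OF r(1), of "of_nat k + \<nu> + 1"]
      unfolding g_def[abs_def] hankel_integral_cmult hankel_F_def by simp
    \<comment> \<open>Here \<open>r ^ k\<close> comes from the coefficient in \<open>g\<close> and
      the other power from Hankel's formula.\<close>
    also have "r powr (2 * of_nat k + \<nu>) = r ^ k * r powr (of_nat k + \<nu>)"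
      using r(2) powr_add[of r "of_nat k" "of_nat k + \<nu>"] by (simp add: powr_nat' add.assoc[symmetric])
    ultimately show ?thesis
      by (simp add: scaleR_conv_of_real power_minus[of r] field_simps)
  qed
  obtain C where C:
    "\<And>q s y. Re q \<ge> Re r \<Longrightarrow> norm q \<le> norm r \<Longrightarrow>
       norm y \<le> exp (norm r) * exp (norm \<nu> * norm (hankel_path s)) \<Longrightarrow>
       norm (exp (q * exp (hankel_path s)) * y) \<le> C * exp (- \<bar>s\<bar>)"
    using hankel_exp_mult_bound[OF r(1)] by blast
  have sum_g: "(\<Sum>k<N. g k w) =
      exp (r * exp w) * ((\<Sum>k<N. (- r * exp (- w)) ^ k /\<^sub>R fact k) * exp (- \<nu> * w))" for N w
    unfolding g by (simp only: sum_distrib_left sum_distrib_right)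
  have "(\<lambda>N. hankel_integral (\<lambda>w. \<Sum>k<N. g k w)) \<longlonglongrightarrow> hankel_integral (bessel_kernel t 0 \<nu>)"
  proof (rule hankel_integral_tendsto)
    show "norm (\<Sum>k<N. g k (hankel_path s)) \<le> C * exp (- \<bar>s\<bar>)" for N s
      unfolding sum_g
    proof (rule C)
      define u where "u = - r * exp (- hankel_path s)"
      have u: "norm u \<le> norm r"
        using norm_exp_minus_hankel_path_le[of s] by (simp add: u_def norm_mult mult_left_le)
      have "norm (\<Sum>k<N. u ^ k /\<^sub>R fact k) \<le> (\<Sum>k<N. norm u ^ k /\<^sub>R fact k)"
        by (rule sum_norm_le) (simp add: norm_power)
      also have "\<dots> \<le> exp (norm u)" by (rule sum_power_fact_le_exp) simp
      also have "\<dots> \<le> exp (norm r)" using u by simp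
      finally have "norm (\<Sum>k<N. u ^ k /\<^sub>R fact k) \<le> exp (norm r)" .
      then show "norm ((\<Sum>k<N. (- r * exp (- hankel_path s)) ^ k /\<^sub>R fact k) * exp (- \<nu> * hankel_path s))
          \<le> exp (norm r) * exp (norm \<nu> * norm (hankel_path s))"
        unfolding u_def[symmetric] norm_mult[of "sum _ _"]
        using norm_exp_mult_le[of "- \<nu>" "hankel_path s"] by (intro mult_mono) auto
    qed auto
    show "(\<lambda>N. \<Sum>k<N. g k (hankel_path s)) \<longlonglongrightarrow> bessel_kernel t 0 \<nu> (hankel_path s)" for s
    proof -
      define u where "u = - r * exp (- hankel_path s)"
      have "(\<lambda>N. \<Sum>k<N. u ^ k /\<^sub>R fact k) \<longlonglongrightarrow> exp u"
        using exp_converges[of u] by (simp add: sums_def)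
      then show ?thesis
        unfolding sum_g bessel_kernel_altdef u_def r_def by (auto intro!: tendsto_intros)
    qed
  qed (auto intro!: continuous_intros cont continuous_bessel_kernel)
  then have "(\<lambda>k. hankel_integral (g k)) sums hankel_integral (bessel_kernel t 0 \<nu>)"
    using hankel_integral_sum[of _ g B] cont B by (simp add: sums_def)
  then show ?thesis
    unfolding Bessel_J_def int_g r_def[symmetric] by (simp add: sums_iff)
qed

section \<open>Differentiation in the order\<close>

lemma hankel_integral_bessel_kernel_has_field_derivative:
  assumes "Re t > 0"
  shows "((\<lambda>\<nu>. hankel_integral (bessel_kernel t n \<nu>)) has_field_derivative
           hankel_integral (bessel_kernel t (Suc n) \<nu>)) (at \<nu>)"
proof -
  have ball: "norm q \<le> norm \<nu> + 1" if "q \<in> ball \<nu> 1" for q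
    using that norm_triangle_sub[of q \<nu>] by (simp add: dist_norm norm_minus_commute)
  obtain B where B: "\<And>q s. norm q \<le> norm \<nu> + 1 \<Longrightarrow> norm (bessel_kernel t n q (hankel_path s)) \<le> B * exp (- \<bar>s\<bar>)"
    using bessel_kernel_bound[OF assms] by blast
  obtain C where C: "\<And>q s. norm q \<le> norm \<nu> + 1 \<Longrightarrow> norm (bessel_kernel t (Suc n) q (hankel_path s)) \<le> C * exp (- \<bar>s\<bar>)"
    using bessel_kernel_bound[OF assms] by blast
  show ?thesis
  proof (rule hankel_integral_has_field_derivative[OF zero_less_one])
    show "((\<lambda>p. bessel_kernel t n p w) has_field_derivative bessel_kernel t (Suc n) p w) (at p)" for p w
      unfolding bessel_kernel_def by (auto intro!: derivative_eq_intros)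
    show "norm (bessel_kernel t n q (hankel_path s)) \<le> B * exp (- \<bar>s\<bar>)"
      "norm (bessel_kernel t (Suc n) q (hankel_path s)) \<le> C * exp (- \<bar>s\<bar>)" if "q \<in> ball \<nu> 1" for q s
      using B C ball[OF that] by blast+
  qed (auto intro: continuous_bessel_kernel)
qed

text \<open>As each \<open>D m\<close> differentiates to the next on the whole line, the
  neighbourhood condition is trivial and \<open>D n\<close> is the witness at every order.\<close>

lemma has_nth_vector_derivativeI:
  assumes "\<And>y. f y = D 0 y" "\<And>m y. (D m has_vector_derivative D (Suc m) y) (at y)"
  shows "has_nth_vector_derivative n f (D n x) x"
proof (induction n arbitrary: x)
  case 0
  then show ?case using assms(1) by simp
next
  case (Suc n)
  then show ?case using assms(2) by (auto intro!: exI[of _ "D n"] always_eventually)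
qed

lemma Bessel_J_has_nth_vector_derivative:
  assumes "Re t > 0"
  shows "has_nth_vector_derivative n (\<lambda>\<mu>. Bessel_J (of_real \<mu>) t)
           (hankel_integral (bessel_kernel t n (of_real \<nu>))) \<nu>"
proof (rule has_nth_vector_derivativeI[where D = "\<lambda>n \<mu>. hankel_integral (bessel_kernel t n (of_real \<mu>))"])
  show "((\<lambda>\<mu>. hankel_integral (bessel_kernel t m (of_real \<mu>))) has_vector_derivative
      hankel_integral (bessel_kernel t (Suc m) (of_real y))) (at y)" for m y
    by (rule has_vector_derivative_real_field)
       (rule hankel_integral_bessel_kernel_has_field_derivative[OF assms])
qed (rule Bessel_J_eq_hankel_integral[OF assms])

section \<open>The two real integrals\<close>

lemma bessel_kernel_imaginary_axis:
  fixes x \<nu> :: real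
  shows "bessel_kernel t n (of_real \<nu>) (\<i> * of_real x) + bessel_kernel t n (of_real \<nu>) (- (\<i> * of_real x)) =
     2 * (of_real (x ^ n) * cos (t * of_real (sin x) - of_real (\<nu> * x) - of_real (pi / 2 * real n)))"
proof -
  define A where "A = t * of_real (sin x) - of_real (\<nu> * x)"
  have sinh: "sinh (\<i> * of_real x) = \<i> * of_real (sin x)"
    by (simp add: sinh_field_def sin_of_real[symmetric] sin_exp_eq exp_minus field_simps)
  have "exp (\<i> * of_real (pi / 2 * real n)) = \<i> ^ n"
  proof -
    have "exp (\<i> * of_real (pi / 2 * real n)) = exp (of_nat n * (\<i> * of_real (pi / 2)))"
      by (simp add: algebra_simps)
    also have "\<dots> = cis (pi / 2) ^ n" unfolding exp_of_nat_mult cis_conv_exp ..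
    also have "\<dots> = \<i> ^ n" by simp
    finally show ?thesis .
  qed
  \<comment> \<open>Identifies \<open>(- \<i>) ^ n\<close> as the inverse phase; the two phases
    \<open>\<i> ^ n\<close> and \<open>(- \<i>) ^ n\<close> become the shift by
    \<open>pi / 2 * n\<close> in the cosine.\<close>
  moreover have "\<i> ^ n * (- \<i>) ^ n = 1" by (simp flip: power_mult_distrib)
  ultimately have "exp (- (\<i> * of_real (pi / 2 * real n))) = (- \<i>) ^ n"
    "exp (\<i> * of_real (pi / 2 * real n)) = \<i> ^ n"
    unfolding exp_minus by (metis inverse_unique)+
  moreover have "exp (\<i> * (A - B)) = exp (\<i> * A) * exp (- (\<i> * B))"
    "exp (- (\<i> * (A - B))) = exp (- (\<i> * A)) * exp (\<i> * B)" for B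
    unfolding exp_add[symmetric] by (simp_all add: right_diff_distrib)
  ultimately have cos: "2 * cos (A - of_real (pi / 2 * real n)) = exp (\<i> * A) * (- \<i>) ^ n + exp (- (\<i> * A)) * \<i> ^ n"
    unfolding cos_exp_eq by simp
  have "t * sinh (\<i> * of_real x) - of_real \<nu> * (\<i> * of_real x) = \<i> * A"
    "t * sinh (- (\<i> * of_real x)) - of_real \<nu> * - (\<i> * of_real x) = - (\<i> * A)"
    by (simp_all add: sinh A_def algebra_simps)
  moreover have "(- (\<i> * of_real x)) ^ n = of_real (x ^ n) * (- \<i>) ^ n"
    "(- (- (\<i> * of_real x))) ^ n = of_real (x ^ n) * \<i> ^ n"
    using power_mult_distrib[of "- \<i>" "of_real x" n] power_mult_distrib[of "\<i>" "of_real x" n] by simp_all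
  ultimately have "bessel_kernel t n (of_real \<nu>) (\<i> * of_real x) = of_real (x ^ n) * (exp (\<i> * A) * (- \<i>) ^ n)"
    "bessel_kernel t n (of_real \<nu>) (- (\<i> * of_real x)) = of_real (x ^ n) * (exp (- (\<i> * A)) * \<i> ^ n)"
    unfolding bessel_kernel_def by (simp_all only: mult_ac)
  then have "bessel_kernel t n (of_real \<nu>) (\<i> * of_real x) + bessel_kernel t n (of_real \<nu>) (- (\<i> * of_real x)) =
      of_real (x ^ n) * (2 * cos (A - of_real (pi / 2 * real n)))"
    unfolding cos by (simp only: distrib_left)
  then show ?thesis
    unfolding A_def by (simp only: mult.left_commute)
qed

text \<open>Translation by \<open>\<plusminus> \<i> * pi\<close> changes the sign of
  \<open>sinh\<close>, so both rays share the factor \<open>E\<close>. The other factors are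
  conjugate, and their difference leaves an imaginary part.\<close>

lemma bessel_kernel_rays:
  fixes x \<nu> :: real
  shows "bessel_kernel t n (of_real \<nu>) (of_real x + \<i> * of_real pi) -
     bessel_kernel t n (of_real \<nu>) (of_real x - \<i> * of_real pi) =
     - 2 * \<i> * (exp (- t * of_real (sinh x) - of_real (\<nu> * x)) *
       of_real (Im ((\<i> * of_real pi - of_real x) ^ n * exp (\<i> * of_real (pi * \<nu>)))))"
proof -
  define A where "A = (\<i> * of_real pi - of_real x) ^ n * exp (\<i> * of_real (pi * \<nu>))"
  define E where "E = exp (- t * of_real (sinh x) - of_real (\<nu> * x))"
  have sinh: "sinh (of_real x + \<i> * of_real pi) = - complex_of_real (sinh x)"
    "sinh (of_real x - \<i> * of_real pi) = - complex_of_real (sinh x)"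
    by (simp_all add: sinh_field_def exp_add exp_diff exp_minus field_simps flip: exp_of_real)
  \<comment> \<open>Only \<open>A\<close> is conjugated: \<open>t\<close> is complex, so
    \<open>E\<close> need not be real.\<close>
  have cnj: "cnj A = (- of_real x - \<i> * of_real pi) ^ n * exp (- (\<i> * of_real (pi * \<nu>)))"
    by (simp add: A_def exp_cnj) (subst minus_diff_commute, rule refl)
  have "bessel_kernel t n (of_real \<nu>) (of_real x + \<i> * of_real pi) = E * cnj A"
  proof -
    have "t * sinh (of_real x + \<i> * of_real pi) - of_real \<nu> * (of_real x + \<i> * of_real pi) =
        (- t * of_real (sinh x) - of_real (\<nu> * x)) + - (\<i> * of_real (pi * \<nu>))"
      unfolding sinh by (simp add: algebra_simps)
    moreover have "- (of_real x + \<i> * of_real pi) = - of_real x - \<i> * of_real pi" by simp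
    ultimately show ?thesis
      unfolding bessel_kernel_def cnj E_def by (simp only: exp_add mult_ac)
  qed
  moreover have "bessel_kernel t n (of_real \<nu>) (of_real x - \<i> * of_real pi) = E * A"
  proof -
    have "t * sinh (of_real x - \<i> * of_real pi) - of_real \<nu> * (of_real x - \<i> * of_real pi) =
        (- t * of_real (sinh x) - of_real (\<nu> * x)) + \<i> * of_real (pi * \<nu>)"
      unfolding sinh by (simp add: algebra_simps)
    moreover have "- (of_real x - \<i> * of_real pi) = \<i> * of_real pi - of_real x" by simp
    ultimately show ?thesis
      unfolding bessel_kernel_def A_def E_def by (simp only: exp_add mult_ac)
  qed
  moreover have "E * cnj A - E * A = - 2 * \<i> * (E * of_real (Im A))"
  proof -
    have "cnj A - A = - 2 * \<i> * of_real (Im A)"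
      by (simp add: complex_eq_iff)
    then show ?thesis
      unfolding right_diff_distrib[symmetric] by (simp only: mult_ac)
  qed
  ultimately show ?thesis
    unfolding A_def[symmetric] E_def[symmetric] by (simp only:)
qed

lemma Im_ipi_minus_power_mult_exp:
  "Im ((\<i> * of_real pi - of_real x) ^ n * exp (\<i> * of_real (pi * \<nu>))) =
     p_poly n x * sin (pi * \<nu>) + q_poly n x * cos (pi * \<nu>)"
  by (simp add: p_poly_def q_poly_def Re_exp Im_exp)

text \<open>As \<open>integral\<close> is 0 on non-integrable functions, the absolute integrability
  clauses certify that the integrals in the formulas are genuine.\<close>

theorem mainTheorem1:
  fixes n :: nat and \<nu> :: real and t :: complex
  assumes "Re t > 0"
  shows
    "(\<lambda>x::real. of_real (x ^ n) *
        cos (t * of_real (sin x) - of_real (\<nu> * x) - of_real (pi / 2 * real n)))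
       absolutely_integrable_on {0..pi} \<and>
     (\<lambda>x::real. exp (- t * of_real (sinh x) - of_real (\<nu> * x)) *
        of_real (Im ((\<i> * of_real pi - of_real x) ^ n * exp (\<i> * of_real (pi * \<nu>)))))
       absolutely_integrable_on {0..} \<and>
     (\<lambda>x::real. exp (- t * of_real (sinh x) - of_real (\<nu> * x)) *
        of_real (p_poly n x * sin (pi * \<nu>) + q_poly n x * cos (pi * \<nu>)))
       absolutely_integrable_on {0..} \<and>
     has_nth_vector_derivative n (\<lambda>\<mu>::real. Bessel_J (of_real \<mu>) t)
       (1 / of_real pi *
          integral {0..pi} (\<lambda>x::real. of_real (x ^ n) *
            cos (t * of_real (sin x) - of_real (\<nu> * x) - of_real (pi / 2 * real n)))
        - 1 / of_real pi *
          integral {0..} (\<lambda>x::real. exp (- t * of_real (sinh x) - of_real (\<nu> * x)) *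
            of_real (Im ((\<i> * of_real pi - of_real x) ^ n * exp (\<i> * of_real (pi * \<nu>))))))
       \<nu> \<and>
     has_nth_vector_derivative n (\<lambda>\<mu>::real. Bessel_J (of_real \<mu>) t)
       (1 / of_real pi *
          integral {0..pi} (\<lambda>x::real. of_real (x ^ n) *
            cos (t * of_real (sin x) - of_real (\<nu> * x) - of_real (pi / 2 * real n)))
        - 1 / of_real pi *
          integral {0..} (\<lambda>x::real. exp (- t * of_real (sinh x) - of_real (\<nu> * x)) *
            of_real (p_poly n x * sin (pi * \<nu>) + q_poly n x * cos (pi * \<nu>))))
       \<nu>"
proof -
  define f where "f x = of_real (x ^ n) *
    cos (t * of_real (sin x) - of_real (\<nu> * x) - of_real (pi / 2 * real n))" for x :: real
  define h where "h x = exp (- t * of_real (sinh x) - of_real (\<nu> * x)) *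
    of_real (Im ((\<i> * of_real pi - of_real x) ^ n * exp (\<i> * of_real (pi * \<nu>))))" for x :: real
  let ?D = "1 / of_real pi * integral {0..pi} f - 1 / of_real pi * integral {0..} h"
  obtain C where "\<And>\<mu> s. norm \<mu> \<le> \<bar>\<nu>\<bar> \<Longrightarrow> norm (bessel_kernel t n \<mu> (hankel_path s)) \<le> C * exp (- \<bar>s\<bar>)"
    using bessel_kernel_bound[OF assms] by blast
  then have C: "norm (bessel_kernel t n (of_real \<nu>) (hankel_path s)) \<le> C * exp (- \<bar>s\<bar>)" for s
    by simp
  note fold = hankel_integral_fold[OF continuous_bessel_kernel C, unfolded
      bessel_kernel_imaginary_axis bessel_kernel_rays, folded f_def h_def]
  \<comment> \<open>The factor \<open>\<i> / 2\<close> cancels the \<open>- 2 * \<i>\<close> that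
    folding produces.\<close>
  have "set_integrable lborel {0<..} (\<lambda>x. (\<i> / 2) * (- 2 * \<i> * h x))"
    using fold(1) by (rule set_integrable_mult_right)
  then have "set_integrable lborel {0<..} h" by simp
  then have h: "set_integrable lborel {0<..} h" "h absolutely_integrable_on {0<..}"
    by (auto simp: set_integrable_def integrable_completion)
  \<comment> \<open>Folding yields the open half-line, the formula uses the closed one; they differ
    by the null set \<open>{0}\<close>.\<close>
  have neg: "negligible {x \<in> {0<..} - {0..}. h x \<noteq> 0}" "negligible {x \<in> {0..} - {0<..}. h x \<noteq> 0}"
    by (rule negligible_subset[of "{0}"]; auto)+
  have h_abs: "h absolutely_integrable_on {0..}"
    using h(2) neg by (rule absolutely_integrable_spike_set)
  have f_abs: "f absolutely_integrable_on {0..pi}"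
    unfolding f_def by (intro absolutely_integrable_continuous_real continuous_intros)
  have "(LBINT x:{0<..}. - 2 * \<i> * h x) = - 2 * \<i> * (LBINT x:{0<..}. h x)"
    by (rule set_integral_mult_right)
  also have "(LBINT x:{0<..}. h x) = integral {0<..} h"
    by (rule set_borel_integral_eq_integral(2)[OF h(1)])
  also have "\<dots> = integral {0..} h"
    using neg by (rule integral_spike_set)
  finally have "(LBINT x:{0<..}. - 2 * \<i> * h x) / (2 * of_real pi * \<i>) = - (1 / of_real pi * integral {0..} h)"
    by simp
  moreover have "integral {0..pi} (\<lambda>x. 2 * f x) / (2 * of_real pi) = 1 / of_real pi * integral {0..pi} f"
    by (subst integral_mult_right) simp
  ultimately have "hankel_integral (bessel_kernel t n (of_real \<nu>)) = ?D"
    unfolding fold(2) by simp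
  then have D: "has_nth_vector_derivative n (\<lambda>\<mu>. Bessel_J (of_real \<mu>) t) ?D \<nu>"
    using Bessel_J_has_nth_vector_derivative[OF assms, of n \<nu>] by (simp only:)
  show ?thesis
    using f_abs h_abs D
    unfolding f_def[abs_def] h_def[abs_def] Im_ipi_minus_power_mult_exp by (intro conjI)
qed

end
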